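(* Let $\lambda>0$, $\delta>0$, $\gamma\ge 0$. Let $N$ be a Poisson process with rate $\lambda$ and let $G$ be the inverse Gaussian subordinator with parameters $\delta,\gamma$, independent of $N$. For integers $k\ge 0$ let $\hat p_k(t)=\mathbb{P}(N(G(t))=k)$, and set $\hat p_{-1}\equiv 0$. Then for every $k\ge 0$ and $t>0$, $$\frac{d^2}{dt^2}\hat p_k(t)-2\delta\gamma\frac{d}{dt}\hat p_k(t)=2\delta^2\lambda\,[\hat p_k(t)-\hat p_{k-1}(t)].$$
   Context: The inverse Gaussian subordinator is $G(t)=\inf\{s>0:\ B(s)+\gamma s>\delta t\}$, where $B$ is a standard Brownian motion. For $t>0$, $G(t)$ has density $$g(x,t)=(2\pi)^{-1/2}\,\delta t\,x^{-3/2}\exp\!\Big(\delta\gamma t-\tfrac12\big(\tfrac{\delta^2t^2}{x}+\gamma^2x\big)\Big),\quad x>0.$$ The Poisson process has $\mathbb{P}(N(x)=k)=e^{-\lambda x}(\lambda x)^k/k!$. *)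

theory Defs
  imports "HOL-Probability.Probability"
begin

text \<open>
  Processes are functions \<open>X :: real \<Rightarrow> 'a \<Rightarrow> 'b\<close>; only the times \<open>t \<ge> 0\<close> matter. Path properties
  are required on the whole sample space rather than almost surely: \<open>M\<close> need not be complete,
  and otherwise the events below might fail to be measurable.
\<close>

definition (in prob_space) indep_increments ::
    "'b measure \<Rightarrow> (real \<Rightarrow> 'a \<Rightarrow> 'b::minus) \<Rightarrow> bool" where
  "indep_increments S X \<longleftrightarrow>
     (\<forall>(n::nat) \<tau>. 0 \<le> \<tau> 0 \<and> (\<forall>i<n. \<tau> i < \<tau> (Suc i)) \<longrightarrow>
        indep_vars (\<lambda>_. S) (\<lambda>i \<omega>. X (\<tau> (Suc i)) \<omega> - X (\<tau> i) \<omega>) {..<n})"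

locale brownian_motion = prob_space M for M :: "'a measure" +
  fixes B :: "real \<Rightarrow> 'a \<Rightarrow> real"
  assumes random_variable: "t \<ge> 0 \<Longrightarrow> B t \<in> borel_measurable M"
    and start: "\<omega> \<in> space M \<Longrightarrow> B 0 \<omega> = 0"
    and increments: "indep_increments borel B"
    and normal_increments: "\<lbrakk>0 \<le> s; s < t\<rbrakk> \<Longrightarrow>
      distributed M lborel (\<lambda>\<omega>. B t \<omega> - B s \<omega>) (normal_density 0 (sqrt (t - s)))"
    and continuous_paths: "\<omega> \<in> space M \<Longrightarrow> continuous_on {0..} (\<lambda>t. B t \<omega>)"

text \<open>The natural number subtraction in the increments is harmless, since the paths are
  nondecreasing.\<close>

locale poisson_process = prob_space M for M :: "'a measure" +
  fixes rate :: real and N :: "real \<Rightarrow> 'a \<Rightarrow> nat"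
  assumes random_variable: "t \<ge> 0 \<Longrightarrow> N t \<in> measurable M (count_space UNIV)"
    and start: "\<omega> \<in> space M \<Longrightarrow> N 0 \<omega> = 0"
    and increments: "indep_increments (count_space UNIV) N"
    and poisson_increments: "\<lbrakk>0 \<le> s; s < t\<rbrakk> \<Longrightarrow>
      distr M (count_space UNIV) (\<lambda>\<omega>. N t \<omega> - N s \<omega>) = measure_pmf (poisson_pmf (rate * (t - s)))"
    and nondecreasing_paths: "\<omega> \<in> space M \<Longrightarrow> mono_on {0..} (\<lambda>t. N t \<omega>)"
    and right_continuous_paths: "\<lbrakk>\<omega> \<in> space M; t \<ge> 0\<rbrakk> \<Longrightarrow> continuous (at_right t) (\<lambda>s. N s \<omega>)"

text \<open>The infimum is taken in the extended reals, so that it is \<open>\<infinity>\<close> if the level \<open>\<delta> * t\<close>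
  is never exceeded.\<close>

definition inverse_gaussian_subordinator ::
    "'a measure \<Rightarrow> real \<Rightarrow> real \<Rightarrow> (real \<Rightarrow> 'a \<Rightarrow> ereal) \<Rightarrow> bool" where
  "inverse_gaussian_subordinator M \<delta> \<gamma> G \<longleftrightarrow>
     (\<exists>B. brownian_motion M B \<and>
        (\<forall>t\<ge>0. \<forall>\<omega>\<in>space M. G t \<omega> = (INF s \<in> {s. 0 < s \<and> B s \<omega> + \<gamma> * s > \<delta> * t}. ereal s)))"

definition process_events :: "'a measure \<Rightarrow> 'b measure \<Rightarrow> (real \<Rightarrow> 'a \<Rightarrow> 'b) \<Rightarrow> 'a set set" where
  "process_events M S X =
     sigma_sets (space M) {X t -` A \<inter> space M | t A. 0 \<le> t \<and> A \<in> sets S}"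

text \<open>Independence of the whole processes. The two value types may differ, hence
  \<open>indep_set\<close> for the generated \<open>\<sigma>\<close>-algebras instead of \<open>indep_var\<close>.\<close>

definition (in prob_space) indep_processes ::
    "'b measure \<Rightarrow> (real \<Rightarrow> 'a \<Rightarrow> 'b) \<Rightarrow> 'c measure \<Rightarrow> (real \<Rightarrow> 'a \<Rightarrow> 'c) \<Rightarrow> bool" where
  "indep_processes S X T Y \<longleftrightarrow> indep_set (process_events M S X) (process_events M T Y)"

text \<open>The probability of \<open>N (G t) = k\<close>. No finite value is attained where \<open>G t = \<infinity>\<close>, which
  is a null event if \<open>\<gamma> \<ge> 0\<close>.\<close>

definition subordinated_prob ::
    "'a measure \<Rightarrow> (real \<Rightarrow> 'a \<Rightarrow> nat) \<Rightarrow> (real \<Rightarrow> 'a \<Rightarrow> ereal) \<Rightarrow> int \<Rightarrow> real \<Rightarrow> real" where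
  "subordinated_prob M N G k t =
     measure M {\<omega> \<in> space M. \<exists>s. G t \<omega> = ereal s \<and> int (N s \<omega>) = k}"

end

theory Submission
  imports Defs
begin

text \<open>
  The density of \<open>G\<close> is avoided. With \<open>F k t u = E [G(t)^k exp (- u G(t))]\<close>, independence gives
  \<open>p k t = rate^k / k! * F k t rate\<close>. Optional stopping of the martingale
  \<open>exp (\<theta> B(s) - \<theta>^2 s / 2)\<close> at the first passage yields \<open>F 0 t u = exp (- \<delta> t (r - \<gamma>))\<close> with
  \<open>r^2 = \<gamma>^2 + 2 u\<close>. As \<open>F (k + 1)\<close> is minus the derivative of \<open>F k\<close> in \<open>u\<close>, repeated differentiation
  in \<open>u\<close> gives \<open>r^2 F (k + 2) - (2 k + 1) F (k + 1) = \<delta>^2 t^2 F k\<close>, and this recurrence transports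
  the first-order relation \<open>t (d/dt - \<delta> \<gamma>) F k = 2 k F k - r^2 F (k + 1)\<close> from \<open>k = 0, 1\<close> to all \<open>k\<close>.
  Applying that relation twice and eliminating \<open>F (k + 2)\<close> and \<open>F (k + 1)\<close> leaves the claimed equation.
\<close>

section \<open>Optional stopping on a time grid\<close>

context prob_space
begin

text \<open>Discrete optional stopping. Whether factor \<open>j\<close> is used is decided by the
  variables before \<open>j\<close>, hence independently of that factor, which has mean 1; so each
  multiplication preserves the expectation.\<close>

lemma stopped_product_expectation:
  fixes X :: "nat \<Rightarrow> 'a \<Rightarrow> real" and f :: "nat \<Rightarrow> real \<Rightarrow> real" and C :: "nat \<Rightarrow> (nat \<Rightarrow> real) set"
  assumes indep: "indep_vars (\<lambda>_. borel) X {..<n}"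
    and f: "\<And>j. f j \<in> borel_measurable borel"
    and int: "\<And>j. j < n \<Longrightarrow> integrable M (\<lambda>\<omega>. f j (X j \<omega>))"
    and mean: "\<And>j. j < n \<Longrightarrow> expectation (\<lambda>\<omega>. f j (X j \<omega>)) = 1"
    and C: "\<And>j. C j \<in> sets (PiM {..<j} (\<lambda>_. borel))"
    and "i \<le> n"
  defines "P \<equiv> \<lambda>i \<omega>. \<Prod>j<i. if restrict (\<lambda>l. X l \<omega>) {..<j} \<in> C j then f j (X j \<omega>) else 1"
  shows "integrable M (P i) \<and> expectation (P i) = 1"
  using \<open>i \<le> n\<close>
proof (induction i)
  case 0
  show ?case by (simp add: P_def prob_space)
next
  case (Suc i)
  then have i: "i < n" and IH: "integrable M (P i)" "expectation (P i) = 1" by auto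
  define Z where "Z \<omega> = restrict (\<lambda>l. X l \<omega>) {..<i}" for \<omega>
  \<comment> \<open>The step from \<open>P i\<close> to \<open>P (Suc i)\<close> adds a function of the past times the centred, independent
    variable \<open>f i (X i) - 1\<close>.\<close>
  define g where "g y = (\<Prod>j<i. if restrict y {..<j} \<in> C j then f j (y j) else 1) * indicator (C i) y"
    for y :: "nat \<Rightarrow> real"
  have [measurable]: "f j \<in> borel_measurable borel" "C j \<in> sets (PiM {..<j} (\<lambda>_. borel))" for j
    using f C by auto
  have g_meas: "g \<in> borel_measurable (PiM {..<i} (\<lambda>_. borel))"
  proof -
    have "(\<lambda>y. if restrict y {..<j} \<in> C j then f j (y j) else 1) \<in> borel_measurable (PiM {..<i} (\<lambda>_. borel))"
      if "j < i" for j
    proof -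
      have "(\<lambda>y. restrict y {..<j}) \<in> measurable (PiM {..<i} (\<lambda>_. borel)) (PiM {..<j} (\<lambda>_. borel))"
        using that by (intro measurable_restrict_subset) auto
      from measurable_sets[OF this C]
      have "{y \<in> space (PiM {..<i} (\<lambda>_. borel)). restrict y {..<j} \<in> C j} \<in> sets (PiM {..<i} (\<lambda>_. borel))"
        by (simp add: vimage_def Int_def conj_commute)
      moreover have "(\<lambda>y. f j (y j)) \<in> borel_measurable (PiM {..<i} (\<lambda>_. borel))"
        using that by (intro measurable_compose[where g = "f j", OF measurable_component_singleton[of j] f]) auto
      ultimately show ?thesis by (intro measurable_If) auto
    qed
    then show ?thesis unfolding g_def
      by (intro borel_measurable_times borel_measurable_prod borel_measurable_indicator) auto
  qed
  \<comment> \<open>Past \<open>{..<i}\<close> and present \<open>{i}\<close> are disjoint index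
    blocks of an independent family, so functions of the two are independent.\<close>
  have "indep_var (PiM {..<i} (\<lambda>_. borel)) (\<lambda>\<omega>. restrict (\<lambda>l. X l \<omega>) {..<i})
          (PiM {i} (\<lambda>_. borel)) (\<lambda>\<omega>. restrict (\<lambda>l. X l \<omega>) {i})"
    using i by (intro indep_var_restrict[OF indep]) auto
  then have "indep_var borel (g \<circ> (\<lambda>\<omega>. restrict (\<lambda>l. X l \<omega>) {..<i}))
          borel ((\<lambda>y. f i (y i) - 1) \<circ> (\<lambda>\<omega>. restrict (\<lambda>l. X l \<omega>) {i}))"
    by (rule indep_var_compose[OF _ g_meas]) (intro borel_measurable_diff borel_measurable_const measurable_compose[where g = "f i", OF measurable_component_singleton[of i] f], auto)
  then have ind: "indep_var borel (\<lambda>\<omega>. g (Z \<omega>)) borel (\<lambda>\<omega>. f i (X i \<omega>) - 1)"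
    by (simp add: comp_def Z_def)
  have gZ: "g (Z \<omega>) = P i \<omega> * indicator (C i) (Z \<omega>)" for \<omega>
  proof -
    have "restrict (Z \<omega>) {..<j} = restrict (\<lambda>l. X l \<omega>) {..<j}" "Z \<omega> j = X j \<omega>" if "j < i" for j
      using that by (auto simp: Z_def restrict_def)
    then show ?thesis unfolding g_def P_def
      by (intro arg_cong2[where f = "(*)"] prod.cong) auto
  qed
  have gZ_int: "integrable M (\<lambda>\<omega>. g (Z \<omega>))"
    using IH(1) indep_var_rv1[OF ind]
    by (rule Bochner_Integration.integrable_bound[where f="P i"]) (auto simp: gZ indicator_def)
  have f_int: "integrable M (\<lambda>\<omega>. f i (X i \<omega>) - 1)"
    using int[OF i] by simp
  have eq: "P (Suc i) \<omega> = P i \<omega> + g (Z \<omega>) * (f i (X i \<omega>) - 1)" for \<omega>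
    unfolding gZ by (auto simp: P_def Z_def indicator_def algebra_simps)
  have "expectation (\<lambda>\<omega>. g (Z \<omega>) * (f i (X i \<omega>) - 1)) = 0"
    using indep_var_lebesgue_integral[OF ind gZ_int f_int] int[OF i] mean[OF i]
    by (simp add: prob_space)
  with indep_var_integrable[OF ind gZ_int f_int] IH show ?case
    unfolding eq by simp
qed

end

section \<open>The exponential martingale of Brownian motion\<close>

text \<open>Completing the square: the exponential weight only moves the mean from 0 to
  \<open>\<theta> * \<sigma>\<^sup>2\<close>, so the weighted density is again a probability
  density.\<close>

lemma normal_density_exponential_tilt:
  assumes "\<sigma> > 0"
  shows "normal_density 0 \<sigma> x * exp (\<theta> * x - \<theta>\<^sup>2 * \<sigma>\<^sup>2 / 2) = normal_density (\<theta> * \<sigma>\<^sup>2) \<sigma> x"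
proof -
  have "- (x - 0)\<^sup>2 / (2 * \<sigma>\<^sup>2) + (\<theta> * x - \<theta>\<^sup>2 * \<sigma>\<^sup>2 / 2) = - (x - \<theta> * \<sigma>\<^sup>2)\<^sup>2 / (2 * \<sigma>\<^sup>2)"
    using assms by (simp add: field_simps power2_eq_square)
  then show ?thesis
    unfolding normal_density_def mult.assoc exp_add[symmetric] by simp
qed

context brownian_motion
begin

text \<open>Supplies the factors of mean 1 for \<open>stopped_product_expectation\<close>: the
  tilted density of the increment has integral 1.\<close>

lemma exponential_increment:
  fixes \<theta> :: real
  assumes "0 \<le> s" "s < t"
  defines "Y \<equiv> \<lambda>\<omega>. exp (\<theta> * (B t \<omega> - B s \<omega>) - \<theta>\<^sup>2 * (t - s) / 2)"
  shows "integrable M Y" and "expectation Y = 1"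
proof -
  let ?\<sigma> = "sqrt (t - s)" and ?g = "\<lambda>x. exp (\<theta> * x - \<theta>\<^sup>2 * (t - s) / 2)"
  note D = normal_increments[OF assms(1,2)]
  have eq: "normal_density 0 ?\<sigma> x * ?g x = normal_density (\<theta> * ?\<sigma>\<^sup>2) ?\<sigma> x" for x
    using normal_density_exponential_tilt[of ?\<sigma> x \<theta>] assms by simp
  have "integrable lborel (\<lambda>x. normal_density 0 ?\<sigma> x * ?g x)"
    unfolding eq using assms by (intro integrable_normal_density) simp
  then show "integrable M Y"
    unfolding Y_def using assms distributed_integrable[OF D, of ?g] by simp
  show "expectation Y = 1"
    unfolding Y_def using assms distributed_integral[OF D, of ?g] by (simp add: eq)
qed

end

section \<open>First passage times\<close>

text \<open>Lets a second moment control the mass lost by truncating at \<open>C\<close>.\<close>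

lemma minus_square_le_min:
  fixes y C :: real assumes "0 \<le> y" "0 < C"
  shows "y - y\<^sup>2 / C \<le> min y C"
proof -
  have "0 \<le> (y - C)\<^sup>2 + y * C" using assms by simp
  then have "y * C \<le> y\<^sup>2 + C * C" by (simp add: power2_diff) (simp add: power2_eq_square algebra_simps)
  then have "y - y\<^sup>2 / C \<le> C" using assms by (simp add: field_simps)
  then show ?thesis using assms by auto
qed

text \<open>Bounded second moments prevent mass from escaping. Fatou gives the upper bound; for the
  lower one, truncation at \<open>C\<close> permits dominated convergence and costs at most
  \<open>D / C\<close>.\<close>

lemma (in prob_space) second_moment_bounded_convergence:
  fixes f :: "nat \<Rightarrow> 'a \<Rightarrow> real"
  assumes nonneg: "\<And>n \<omega>. \<omega> \<in> space M \<Longrightarrow> 0 \<le> f n \<omega>"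
    and int: "\<And>n. integrable M (f n)" and mean: "\<And>n. expectation (f n) = c"
    and int2: "\<And>n. integrable M (\<lambda>\<omega>. (f n \<omega>)\<^sup>2)"
    and bound: "\<And>n. expectation (\<lambda>\<omega>. (f n \<omega>)\<^sup>2) \<le> D"
    and lim: "\<And>\<omega>. \<omega> \<in> space M \<Longrightarrow> (\<lambda>n. f n \<omega>) \<longlonglongrightarrow> g \<omega>"
  shows "integrable M g" and "expectation g = c"
proof -
  have [measurable]: "f n \<in> borel_measurable M" for n using int by auto
  have g_meas [measurable]: "g \<in> borel_measurable M"
    using lim by (rule borel_measurable_LIMSEQ_real) auto
  have g_nonneg: "0 \<le> g \<omega>" if "\<omega> \<in> space M" for \<omega>
    using lim[OF that] nonneg[OF that] by (intro LIMSEQ_le_const) auto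
  have nn_f: "(\<integral>\<^sup>+\<omega>. ennreal (f n \<omega>) \<partial>M) = ennreal c" for n
    using nn_integral_eq_integral[OF int[of n]] nonneg mean by simp
  have "(\<integral>\<^sup>+\<omega>. ennreal (g \<omega>) \<partial>M) = (\<integral>\<^sup>+\<omega>. liminf (\<lambda>n. ennreal (f n \<omega>)) \<partial>M)"
    using lim by (intro nn_integral_cong) (auto intro!: lim_imp_Liminf[symmetric])
  also have "\<dots> \<le> liminf (\<lambda>n. \<integral>\<^sup>+\<omega>. ennreal (f n \<omega>) \<partial>M)"
    by (rule nn_integral_liminf) simp
  also have "\<dots> = ennreal c" by (simp add: nn_f Liminf_const)
  finally have fatou: "(\<integral>\<^sup>+\<omega>. ennreal (g \<omega>) \<partial>M) \<le> ennreal c" .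
  show g_int: "integrable M g"
    by (rule integrableI_nonneg) (use fatou g_nonneg in \<open>auto simp: less_top[symmetric] top_unique\<close>)
  \<comment> \<open>\<open>ennreal\<close> sends negative reals to 0, so the sign of
    \<open>c\<close> must be known before Fatou's bound is read in the reals.\<close>
  have "0 \<le> c" using mean[of 0] nonneg[of _ 0] by (auto intro: Bochner_Integration.integral_nonneg)
  then have upper: "expectation g \<le> c"
    using fatou g_nonneg nn_integral_eq_integral[OF g_int] by simp
  have lower: "c - D / C \<le> expectation g" if "0 < C" for C
  proof -
    have "(\<lambda>n. expectation (\<lambda>\<omega>. min (f n \<omega>) C)) \<longlonglongrightarrow> expectation (\<lambda>\<omega>. min (g \<omega>) C)"
      by (rule integral_dominated_convergence[where w="\<lambda>_. C"])
         (use lim nonneg that in \<open>auto intro!: tendsto_intros AE_I2\<close>)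
    moreover have "c - D / C \<le> expectation (\<lambda>\<omega>. min (f n \<omega>) C)" for n
    proof -
      have "expectation (\<lambda>\<omega>. f n \<omega> - (f n \<omega>)\<^sup>2 / C) \<le> expectation (\<lambda>\<omega>. min (f n \<omega>) C)"
        using int int2 that nonneg by (intro integral_mono minus_square_le_min) auto
      moreover have "expectation (\<lambda>\<omega>. f n \<omega> - (f n \<omega>)\<^sup>2 / C) \<ge> c - D / C"
        using int int2 that mean bound[of n] by (simp add: divide_right_mono)
      ultimately show ?thesis by simp
    qed
    ultimately have "c - D / C \<le> expectation (\<lambda>\<omega>. min (g \<omega>) C)"
      by (intro LIMSEQ_le_const) auto
    also have "\<dots> \<le> expectation g"
      using g_int by (intro integral_mono) auto
    finally show ?thesis .
  qed
  have "(\<lambda>n. c - D / real (Suc n)) \<longlonglongrightarrow> c - 0"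
    by (intro tendsto_diff tendsto_const LIMSEQ_Suc[OF lim_const_over_n])
  then have "c \<le> expectation g"
    using lower by (intro LIMSEQ_le_const2[of _ c]) auto
  with upper show "expectation g = c" by simp
qed

section \<open>Passage times of continuous paths and their grid approximation\<close>

text \<open>The infimum from \<open>inverse_gaussian_subordinator\<close>, isolated for a single
  deterministic path.\<close>

definition first_passage :: "(real \<Rightarrow> real) \<Rightarrow> real \<Rightarrow> ereal" where
  "first_passage x a = (INF s \<in> {s. 0 < s \<and> a < x s}. ereal s)"

text \<open>The alternative \<open>j = n\<close> guarantees that the least index exists and caps the
  time at the horizon \<open>K\<close>.\<close>

definition grid_passage :: "(real \<Rightarrow> real) \<Rightarrow> real \<Rightarrow> real \<Rightarrow> nat \<Rightarrow> real" where
  "grid_passage x a K n = K * real (LEAST j. j = n \<or> a < x (K * real j / real n)) / real n"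

lemma grid_passage_bounds:
  assumes "0 < K" "0 < n"
  shows "0 \<le> grid_passage x a K n" "grid_passage x a K n \<le> K"
proof -
  have "(LEAST j. j = n \<or> a < x (K * real j / real n)) \<le> n" by (rule Least_le) simp
  then show "grid_passage x a K n \<le> K"
    using assms by (simp add: grid_passage_def field_simps)
qed (use assms in \<open>simp add: grid_passage_def\<close>)

lemma first_passage_nonneg: "0 \<le> first_passage x a"
  unfolding first_passage_def by (rule INF_greatest) auto

text \<open>A continuous path above \<open>a\<close> at \<open>s\<close> is above \<open>a\<close>
  slightly earlier too, which would put the infimum strictly before \<open>s\<close>. Hence the
  bound also covers the passage time itself.\<close>

lemma before_first_passage:
  assumes cont: "continuous_on {0..} x" and start: "x 0 \<le> a"
    and s: "0 \<le> s" "ereal s \<le> first_passage x a"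
  shows "x s \<le> a"
proof (rule ccontr)
  assume "\<not> x s \<le> a"
  then have xs: "a < x s" and "0 < s" using start s(1) by (auto simp: order_le_less)
  have "\<forall>\<^sub>F r in at s within {0..}. a < x r"
    using cont s(1) xs by (intro order_tendstoD) (auto simp: continuous_on)
  then obtain d where d: "d > 0" "\<And>r. 0 \<le> r \<Longrightarrow> r \<noteq> s \<Longrightarrow> dist r s < d \<Longrightarrow> a < x r"
    unfolding eventually_at by auto
  \<comment> \<open>Half of the minimum keeps \<open>r\<close> positive and within \<open>d\<close>
    of \<open>s\<close>.\<close>
  define r where "r = s - min d s / 2"
  have "0 < r" "r < s" "a < x r"
    using d \<open>0 < s\<close> by (auto simp: r_def dist_real_def min_def)
  then have "first_passage x a \<le> ereal r"
    unfolding first_passage_def by (intro INF_lower) auto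
  then show False using s(2) \<open>r < s\<close> by (metis ereal_less_eq(3) not_less order_trans)
qed

text \<open>If the path were below \<open>a\<close> at \<open>\<tau>\<close>, it would stay below on
  a neighbourhood, and the infimum would be at least \<open>\<tau> + d\<close>.\<close>

lemma at_first_passage:
  assumes cont: "continuous_on {0..} x" and start: "x 0 \<le> a" and \<tau>: "first_passage x a = ereal \<tau>"
  shows "x \<tau> = a"
proof (rule antisym)
  have nonneg: "0 \<le> \<tau>" using first_passage_nonneg[of x a] \<tau> by simp
  then show "x \<tau> \<le> a" using before_first_passage[OF cont start] \<tau> by simp
  show "a \<le> x \<tau>"
  proof (rule ccontr)
    assume "\<not> a \<le> x \<tau>"
    then have "\<forall>\<^sub>F r in at \<tau> within {0..}. x r < a"
      using cont nonneg by (intro order_tendstoD) (auto simp: continuous_on)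
    then obtain d where d: "d > 0" "\<And>r. 0 \<le> r \<Longrightarrow> r \<noteq> \<tau> \<Longrightarrow> dist r \<tau> < d \<Longrightarrow> x r < a"
      unfolding eventually_at by auto
    have "ereal (\<tau> + d) \<le> first_passage x a"
      unfolding first_passage_def
    proof (rule INF_greatest)
      fix s assume "s \<in> {s. 0 < s \<and> a < x s}"
      then have s: "0 < s" "a < x s" by auto
      then have "first_passage x a \<le> ereal s"
        unfolding first_passage_def by (intro INF_lower) auto
      then have "\<tau> \<le> s" using \<tau> by simp
      with s d(2)[of s] \<open>\<not> a \<le> x \<tau>\<close> show "ereal (\<tau> + d) \<le> ereal s"
        by (cases "s = \<tau>") (auto simp: dist_real_def not_less[symmetric])
    qed
    then show False using \<tau> d(1) by simp
  qed
qed

text \<open>The grid can only detect the passage late. Conversely, an exceedance shortly after the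
  passage time persists on an interval by continuity, and a fine grid hits that interval.\<close>

lemma grid_passage_tendsto:
  assumes cont: "continuous_on {0..} x" and start: "x 0 \<le> a" and "0 < K"
  shows "(\<lambda>n. grid_passage x a K (Suc n)) \<longlonglongrightarrow> real_of_ereal (min (first_passage x a) (ereal K))"
proof (cases "ereal K \<le> first_passage x a")
  case True
  have "grid_passage x a K (Suc n) = K" for n
  proof -
    have "(LEAST j. j = Suc n \<or> a < x (K * real j / real (Suc n))) = Suc n"
    proof (rule Least_equality)
      fix j assume j: "j = Suc n \<or> a < x (K * real j / real (Suc n))"
      show "Suc n \<le> j"
      proof (rule ccontr)
        assume *: "\<not> Suc n \<le> j"
        then have "K * real j / real (Suc n) \<le> K"
          using \<open>0 < K\<close> by (simp add: divide_le_eq mult_left_mono del: of_nat_Suc)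
        then have "ereal (K * real j / real (Suc n)) \<le> first_passage x a"
          using True by (meson ereal_less_eq(3) order_trans)
        then have "x (K * real j / real (Suc n)) \<le> a"
          using \<open>0 < K\<close> by (intro before_first_passage[OF cont start]) auto
        with j * show False by auto
      qed
    qed simp
    then show ?thesis by (simp add: grid_passage_def del: of_nat_Suc)
  qed
  then show ?thesis using True by (simp add: min_absorb2)
next
  case False
  then obtain \<tau> where \<tau>: "first_passage x a = ereal \<tau>" "\<tau> < K" "0 \<le> \<tau>"
    using first_passage_nonneg[of x a] by (cases "first_passage x a") auto
  have lower: "\<tau> \<le> grid_passage x a K (Suc n)" for n
  proof -
    define J where "J = (LEAST j. j = Suc n \<or> a < x (K * real j / real (Suc n)))"
    have "J = Suc n \<or> a < x (K * real J / real (Suc n))"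
      unfolding J_def by (rule LeastI_ex) auto
    then show ?thesis
    proof
      assume "J = Suc n"
      then show ?thesis using \<tau> unfolding grid_passage_def J_def[symmetric]
        by (simp del: of_nat_Suc)
    next
      assume *: "a < x (K * real J / real (Suc n))"
      \<comment> \<open>\<open>first_passage\<close> admits positive times only, so index 0 has to
        be excluded.\<close>
      then have "J \<noteq> 0" using start by (intro notI) simp
      with * \<open>0 < K\<close> have "first_passage x a \<le> ereal (K * real J / real (Suc n))"
        unfolding first_passage_def by (intro INF_lower) auto
      then show ?thesis using \<tau> unfolding grid_passage_def J_def[symmetric] by simp
    qed
  qed
  have upper: "\<forall>\<^sub>F n in sequentially. grid_passage x a K (Suc n) < \<tau> + e" if e: "0 < e" "\<tau> + e \<le> K" for e
  proof -
    have "first_passage x a < ereal (\<tau> + e)" using \<tau> e by simp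
    then obtain s where s: "0 < s" "a < x s" "s < \<tau> + e"
      unfolding first_passage_def INF_less_iff by auto
    have "\<forall>\<^sub>F r in at s within {0..}. a < x r"
      using cont s by (intro order_tendstoD) (auto simp: continuous_on)
    then obtain d where d: "d > 0" "\<And>r. 0 \<le> r \<Longrightarrow> r \<noteq> s \<Longrightarrow> dist r s < d \<Longrightarrow> a < x r"
      unfolding eventually_at by auto
    \<comment> \<open>A mesh below \<open>e'\<close> puts the next grid point after \<open>s\<close>
      both inside the interval of exceedance and before \<open>\<tau> + e\<close>.\<close>
    define e' where "e' = min d (\<tau> + e - s)"
    have "0 < e'" using d s by (simp add: e'_def)
    have "\<forall>\<^sub>F n in sequentially. K / real (Suc n) < e'"
      using order_tendstoD(2)[OF LIMSEQ_Suc[OF lim_const_over_n[of K]] \<open>0 < e'\<close>] .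
    then show ?thesis
    proof eventually_elim
      case (elim n)
      define j where "j = nat \<lceil>s * real (Suc n) / K\<rceil>"
      define r where "r = K * real j / real (Suc n)"
      have "s * real (Suc n) / K \<le> real j" "real j < s * real (Suc n) / K + 1"
        using s(1) \<open>0 < K\<close> unfolding j_def by (auto simp del: of_nat_Suc; linarith)+
      then have r: "s \<le> r" "r < s + K / real (Suc n)"
        using \<open>0 < K\<close> unfolding r_def by (simp_all add: field_simps del: of_nat_Suc)
      then have "a < x r"
        using d(2)[of r] s elim by (cases "r = s") (auto simp: dist_real_def e'_def)
      then have "(LEAST j. j = Suc n \<or> a < x (K * real j / real (Suc n))) \<le> j"
        unfolding r_def by (intro Least_le) auto
      then have "grid_passage x a K (Suc n) \<le> r"
        using \<open>0 < K\<close> unfolding grid_passage_def r_def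
        by (intro divide_right_mono mult_left_mono) auto
      also have "r < \<tau> + e" using r elim by (simp add: e'_def)
      finally show ?case .
    qed
  qed
  have "(\<lambda>n. grid_passage x a K (Suc n)) \<longlonglongrightarrow> \<tau>"
  proof (rule order_tendstoI)
    fix l assume "l < \<tau>"
    then show "\<forall>\<^sub>F n in sequentially. l < grid_passage x a K (Suc n)"
      using lower by (intro always_eventually allI) (meson less_le_trans)
  next
    fix l assume "\<tau> < l"
    \<comment> \<open>The minimum respects the condition \<open>\<tau> + e \<le> K\<close> of
      \<open>upper\<close>.\<close>
    then have "\<forall>\<^sub>F n in sequentially. grid_passage x a K (Suc n) < \<tau> + min (l - \<tau>) (K - \<tau>)"
      using \<tau> by (intro upper) auto
    then show "\<forall>\<^sub>F n in sequentially. grid_passage x a K (Suc n) < l"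
      by (rule eventually_mono) linarith
  qed
  then show ?thesis using \<tau> by (simp add: min_def)
qed

section \<open>Optional stopping at the first passage of Brownian motion with drift\<close>

context brownian_motion
begin

text \<open>With the grid increments as variables, the product in
  \<open>stopped_product_expectation\<close> telescopes to the exponential martingale at the grid
  passage time.\<close>

lemma grid_passage_martingale:
  fixes \<theta> \<gamma> a K :: real
  assumes "0 < K" "0 < n" "0 \<le> a"
  defines "\<sigma> \<equiv> \<lambda>\<omega>. grid_passage (\<lambda>s. B s \<omega> + \<gamma> * s) a K n"
  defines "Y \<equiv> \<lambda>\<omega>. exp (\<theta> * B (\<sigma> \<omega>) \<omega> - \<theta>\<^sup>2 * \<sigma> \<omega> / 2)"
  shows "integrable M Y" and "expectation Y = 1"
proof -
  define s where "s j = K * real j / real n" for j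
  define X where "X j \<omega> = B (s (Suc j)) \<omega> - B (s j) \<omega>" for j \<omega>
  define f where "f (j::nat) x = exp (\<theta> * x - \<theta>\<^sup>2 * (s (Suc j) - s j) / 2)" for j x
  \<comment> \<open>The increment over \<open>[s j, s (Suc j)]\<close> is used while the level has
    not been exceeded at any grid point up to and including \<open>s j\<close>. The sums of past
    increments recover the path there, so the first \<open>j\<close> increments decide this.\<close>
  define C where "C j = {y \<in> space (PiM {..<j} (\<lambda>_. borel)). \<forall>l\<in>{..j}. (\<Sum>i<l. y i) + \<gamma> * s l \<le> a}" for j
  define P where "P \<omega> = (\<Prod>j<n. if restrict (\<lambda>l. X l \<omega>) {..<j} \<in> C j then f j (X j \<omega>) else 1)" for \<omega>
  have s_mono: "s j < s (Suc j)" and s_nonneg: "0 \<le> s j" and s0: "s 0 = 0" for j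
    using assms by (auto simp: s_def field_simps)
  have C_sets: "C j \<in> sets (PiM {..<j} (\<lambda>_. borel))" for j
  proof -
    have "(\<lambda>y. (\<Sum>i<l. y i) + \<gamma> * s l) \<in> borel_measurable (PiM {..<j} (\<lambda>_. borel))" if "l \<in> {..j}" for l
      using that by (intro borel_measurable_add borel_measurable_sum measurable_component_singleton) auto
    then show ?thesis unfolding C_def
      by (intro sets.sets_Collect_finite_All borel_measurable_le) auto
  qed
  have "indep_vars (\<lambda>_. borel) X {..<n}"
    using increments s_nonneg s_mono unfolding indep_increments_def X_def by blast
  moreover have "integrable M (\<lambda>\<omega>. f j (X j \<omega>))" "expectation (\<lambda>\<omega>. f j (X j \<omega>)) = 1" for j
    unfolding f_def X_def using exponential_increment[OF s_nonneg s_mono] by auto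
  ultimately have P: "integrable M P \<and> expectation P = 1"
    unfolding P_def by (intro stopped_product_expectation C_sets) (auto simp: f_def)
  have "P \<omega> = Y \<omega>" if \<omega>: "\<omega> \<in> space M" for \<omega>
  proof -
    define J where "J = (LEAST j. j = n \<or> a < B (s j) \<omega> + \<gamma> * s j)"
    have J: "J = n \<or> a < B (s J) \<omega> + \<gamma> * s J"
      unfolding J_def by (rule LeastI_ex) auto
    have "J \<le> n" unfolding J_def by (rule Least_le) simp
    have sumX: "(\<Sum>i<l. X i \<omega>) = B (s l) \<omega>" for l
      unfolding X_def using start[OF \<omega>] by (simp add: sum_lessThan_telescope[of "\<lambda>j. B (s j) \<omega>"] s0)
    have in_C: "restrict (\<lambda>l. X l \<omega>) {..<j} \<in> C j \<longleftrightarrow> j < J" if "j < n" for j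
    proof -
      have "restrict (\<lambda>l. X l \<omega>) {..<j} \<in> C j \<longleftrightarrow> (\<forall>l\<in>{..j}. B (s l) \<omega> + \<gamma> * s l \<le> a)"
      proof -
        have "(\<Sum>i<l. restrict (\<lambda>l. X l \<omega>) {..<j} i) = B (s l) \<omega>" if "l \<le> j" for l
          using that by (subst sumX[symmetric]) (intro sum.cong, auto)
        then show ?thesis by (auto simp: C_def space_PiM)
      qed
      also have "\<dots> \<longleftrightarrow> j < J"
      proof
        assume *: "\<forall>l\<in>{..j}. B (s l) \<omega> + \<gamma> * s l \<le> a"
        show "j < J"
        proof (rule ccontr)
          assume "\<not> j < J"
          then have "J \<le> j" by simp
          with * have "B (s J) \<omega> + \<gamma> * s J \<le> a" by simp
          then show False using J \<open>J \<le> j\<close> that by auto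
        qed
      next
        assume "j < J"
        show "\<forall>l\<in>{..j}. B (s l) \<omega> + \<gamma> * s l \<le> a"
        proof
          fix l assume "l \<in> {..j}"
          then have "l < J" using \<open>j < J\<close> by auto
          from not_less_Least[OF this[unfolded J_def]] show "B (s l) \<omega> + \<gamma> * s l \<le> a" by auto
        qed
      qed
      finally show ?thesis .
    qed
    have "P \<omega> = (\<Prod>j<n. if j \<in> {..<J} then f j (X j \<omega>) else 1)"
      unfolding P_def by (intro prod.cong) (auto simp: in_C)
    also have "\<dots> = (\<Prod>j<J. f j (X j \<omega>))"
      using \<open>J \<le> n\<close> by (subst prod.inter_restrict[symmetric]) (auto intro!: prod.cong)
    also have "\<dots> = exp (\<Sum>j<J. \<theta> * X j \<omega> - \<theta>\<^sup>2 / 2 * (s (Suc j) - s j))"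
      unfolding f_def by (simp add: exp_sum)
    also have "(\<Sum>j<J. \<theta> * X j \<omega> - \<theta>\<^sup>2 / 2 * (s (Suc j) - s j)) = \<theta> * B (s J) \<omega> - \<theta>\<^sup>2 / 2 * s J"
    proof -
      have "(\<Sum>j<J. s (Suc j) - s j) = s J" by (simp add: sum_lessThan_telescope s0)
      then show ?thesis
        by (simp only: sum_subtractf[of "\<lambda>j. \<theta> * X j \<omega>"] sum_distrib_left[symmetric] sumX)
    qed
    also have "s J = \<sigma> \<omega>"
      unfolding \<sigma>_def grid_passage_def J_def s_def ..
    finally show ?thesis by (simp add: Y_def)
  qed
  then have "integrable M Y \<longleftrightarrow> integrable M P" "expectation Y = expectation P"
    by (auto intro!: Bochner_Integration.integrable_cong Bochner_Integration.integral_cong)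
  with P show "integrable M Y" "expectation Y = 1" by auto
qed

text \<open>The mesh tends to 0: path continuity gives pointwise convergence, and the horizon
  \<open>K\<close> bounds the second moments by \<open>exp (\<theta>\<^sup>2 * K)\<close>, so
  expectations converge as well.\<close>

lemma stopped_martingale:
  fixes \<theta> \<gamma> a K :: real
  assumes "0 < K" "0 \<le> a"
  defines "\<sigma> \<equiv> \<lambda>\<omega>. real_of_ereal (min (first_passage (\<lambda>s. B s \<omega> + \<gamma> * s) a) (ereal K))"
  defines "Y \<equiv> \<lambda>\<omega>. exp (\<theta> * B (\<sigma> \<omega>) \<omega> - \<theta>\<^sup>2 * \<sigma> \<omega> / 2)"
  shows "integrable M Y" and "expectation Y = 1"
proof -
  define \<sigma>' where "\<sigma>' n \<omega> = grid_passage (\<lambda>s. B s \<omega> + \<gamma> * s) a K (Suc n)" for n \<omega>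
  define Y' where "Y' \<theta> n \<omega> = exp (\<theta> * B (\<sigma>' n \<omega>) \<omega> - \<theta>\<^sup>2 * \<sigma>' n \<omega> / 2)" for \<theta> n \<omega>
  have Y': "integrable M (Y' \<theta> n)" "expectation (Y' \<theta> n) = 1" for \<theta> n
    unfolding Y'_def \<sigma>'_def by (rule grid_passage_martingale[OF assms(1) zero_less_Suc assms(2)])+
  have [measurable]: "Y' \<theta> n \<in> borel_measurable M" for n using Y' by auto
  \<comment> \<open>The square is controlled by the same martingale with parameter \<open>2 * \<theta>\<close>.\<close>
  have square: "(Y' \<theta> n \<omega>)\<^sup>2 \<le> exp (\<theta>\<^sup>2 * K) * Y' (2 * \<theta>) n \<omega>" for n \<omega>
  proof -
    have "(Y' \<theta> n \<omega>)\<^sup>2 = exp (\<theta>\<^sup>2 * \<sigma>' n \<omega>) * Y' (2 * \<theta>) n \<omega>"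
      unfolding Y'_def exp_double[symmetric] exp_add[symmetric] power2_eq_square
      by (simp add: algebra_simps)
    also have "\<dots> \<le> exp (\<theta>\<^sup>2 * K) * Y' (2 * \<theta>) n \<omega>"
      using grid_passage_bounds[of K "Suc n"] assms(1)
      by (intro mult_right_mono) (simp_all add: Y'_def \<sigma>'_def mult_left_mono)
    finally show ?thesis .
  qed
  have int2: "integrable M (\<lambda>\<omega>. (Y' \<theta> n \<omega>)\<^sup>2)" for n
  proof (rule Bochner_Integration.integrable_bound)
    show "integrable M (\<lambda>\<omega>. exp (\<theta>\<^sup>2 * K) * Y' (2 * \<theta>) n \<omega>)"
      by (intro integrable_mult_right Y')
    show "AE \<omega> in M. norm ((Y' \<theta> n \<omega>)\<^sup>2) \<le> norm (exp (\<theta>\<^sup>2 * K) * Y' (2 * \<theta>) n \<omega>)"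
      unfolding real_norm_def abs_power2 by (intro AE_I2 order_trans[OF square abs_ge_self])
  qed measurable
  have "expectation (\<lambda>\<omega>. (Y' \<theta> n \<omega>)\<^sup>2) \<le> expectation (\<lambda>\<omega>. exp (\<theta>\<^sup>2 * K) * Y' (2 * \<theta>) n \<omega>)" for n
    by (intro integral_mono int2 integrable_mult_right Y' square)
  then have bound: "expectation (\<lambda>\<omega>. (Y' \<theta> n \<omega>)\<^sup>2) \<le> exp (\<theta>\<^sup>2 * K)" for n
    by (simp add: Y'(2))
  have lim: "(\<lambda>n. Y' \<theta> n \<omega>) \<longlonglongrightarrow> Y \<omega>" if \<omega>: "\<omega> \<in> space M" for \<omega>
  proof -
    note cont = continuous_paths[OF \<omega>]
    have \<sigma>_lim: "(\<lambda>n. \<sigma>' n \<omega>) \<longlonglongrightarrow> \<sigma> \<omega>"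
      unfolding \<sigma>_def \<sigma>'_def
      by (rule grid_passage_tendsto) (use assms(1,2) cont start[OF \<omega>] in \<open>auto intro!: continuous_intros\<close>)
    \<comment> \<open>Paths are continuous on \<open>{0..}\<close> only, so all times in the limit
      must be nonnegative.\<close>
    moreover have \<sigma>'_nonneg: "0 \<le> \<sigma>' n \<omega>" for n
      using grid_passage_bounds[of K "Suc n"] assms(1) unfolding \<sigma>'_def by auto
    ultimately have \<sigma>_nonneg: "0 \<le> \<sigma> \<omega>" by (intro LIMSEQ_le_const) auto
    have B_lim: "(\<lambda>n. B (\<sigma>' n \<omega>) \<omega>) \<longlonglongrightarrow> B (\<sigma> \<omega>) \<omega>"
      by (rule continuous_on_tendsto_compose[OF cont \<sigma>_lim]) (use \<sigma>_nonneg \<sigma>'_nonneg in auto)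
    show ?thesis unfolding Y_def Y'_def
      by (intro tendsto_exp tendsto_diff tendsto_mult tendsto_divide tendsto_const B_lim \<sigma>_lim) simp
  qed
  have "0 \<le> Y' \<theta> n \<omega>" for n \<omega> by (simp add: Y'_def)
  note this Y' int2 bound lim
  from second_moment_bounded_convergence[where f = "Y' \<theta>" and g = Y, OF this]
  show "integrable M Y" "expectation Y = 1" by blast+
qed

text \<open>The horizon tends to infinity. Up to the passage the drifted path is at most
  \<open>a\<close>, so the stopped martingale is bounded by \<open>exp (\<theta> * a)\<close> and
  dominated convergence applies. At a finite passage the path equals \<open>a\<close>; without one
  the factor \<open>exp (- u * \<sigma> n \<omega>)\<close> forces the limit 0. Hence 1 is
  \<open>exp (\<theta> * a)\<close> times the expectation of \<open>L\<close>.\<close>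

lemma first_passage_laplace:
  fixes \<theta> \<gamma> a :: real
  assumes "0 < \<theta>" "0 \<le> \<gamma>" "0 \<le> a"
  defines "T \<equiv> \<lambda>\<omega>. first_passage (\<lambda>s. B s \<omega> + \<gamma> * s) a"
  defines "u \<equiv> \<theta> * \<gamma> + \<theta>\<^sup>2 / 2"
  defines "L \<equiv> \<lambda>\<omega>. if T \<omega> = \<infinity> then 0 else exp (- u * real_of_ereal (T \<omega>))"
  shows "integrable M L" and "expectation L = exp (- \<theta> * a)"
proof -
  define \<sigma> where "\<sigma> n \<omega> = real_of_ereal (min (T \<omega>) (ereal (real (Suc n))))" for n \<omega>
  define Y where "Y n \<omega> = exp (\<theta> * B (\<sigma> n \<omega>) \<omega> - \<theta>\<^sup>2 * \<sigma> n \<omega> / 2)" for n \<omega>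
  have Y: "integrable M (Y n)" "expectation (Y n) = 1" for n
    using stopped_martingale[OF _ assms(3), of "real (Suc n)" \<theta> \<gamma>]
    unfolding Y_def \<sigma>_def T_def by simp_all
  have "0 < u" using assms by (simp add: u_def add_nonneg_pos)
  \<comment> \<open>The choice of \<open>u\<close> regroups the exponent into the drifted path,
    controlled by the level, and a decay in time.\<close>
  have Y_eq: "Y n \<omega> = exp (\<theta> * (B (\<sigma> n \<omega>) \<omega> + \<gamma> * \<sigma> n \<omega>)) * exp (- u * \<sigma> n \<omega>)" for n \<omega>
    unfolding Y_def u_def exp_add[symmetric] by (simp add: algebra_simps add_divide_distrib)
  have T_nonneg: "0 \<le> T \<omega>" for \<omega> unfolding T_def by (rule first_passage_nonneg)
  have \<sigma>: "0 \<le> \<sigma> n \<omega>" "ereal (\<sigma> n \<omega>) \<le> T \<omega>" for n \<omega>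
    using T_nonneg[of \<omega>] by (cases "T \<omega>"; simp add: \<sigma>_def min_def)+
  have path: "continuous_on {0..} (\<lambda>s. B s \<omega> + \<gamma> * s)" "B 0 \<omega> + \<gamma> * 0 \<le> a" if "\<omega> \<in> space M" for \<omega>
    using continuous_paths[OF that] start[OF that] assms by (auto intro!: continuous_intros)
  have level: "exp (\<theta> * (B (\<sigma> n \<omega>) \<omega> + \<gamma> * \<sigma> n \<omega>)) \<le> exp (\<theta> * a)" if "\<omega> \<in> space M" for n \<omega>
    using before_first_passage[OF path[OF that] \<sigma>[unfolded T_def]] assms(1) by simp
  have bound: "Y n \<omega> \<le> exp (\<theta> * a)" if "\<omega> \<in> space M" for n \<omega>
  proof -
    have "exp (- u * \<sigma> n \<omega>) \<le> 1" using \<sigma>(1) \<open>0 < u\<close> by simp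
    then show ?thesis unfolding Y_eq using level[OF that, of n] by (metis exp_ge_zero mult_mono mult.right_neutral)
  qed
  have lim: "(\<lambda>n. Y n \<omega>) \<longlonglongrightarrow> exp (\<theta> * a) * L \<omega>" if \<omega>: "\<omega> \<in> space M" for \<omega>
  proof (cases "T \<omega>")
    case (real \<tau>)
    have "B \<tau> \<omega> + \<gamma> * \<tau> = a"
      using at_first_passage[OF path[OF \<omega>]] real unfolding T_def by simp
    moreover have "\<forall>\<^sub>F n in sequentially. \<sigma> n \<omega> = \<tau>"
    proof -
      obtain m :: nat where "\<tau> \<le> real m" using real_arch_simple by blast
      then have "\<sigma> n \<omega> = \<tau>" if "n \<ge> m" for n using that by (simp add: \<sigma>_def real min_def)
      then show ?thesis by (auto simp: eventually_sequentially)
    qed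
    ultimately have "\<forall>\<^sub>F n in sequentially. Y n \<omega> = exp (\<theta> * a) * L \<omega>"
      by (auto simp: Y_eq L_def real elim!: eventually_mono)
    then show ?thesis by (rule tendsto_eventually)
  next
    case PInf
    then have \<sigma>_eq: "\<sigma> n \<omega> = real (Suc n)" for n by (simp add: \<sigma>_def)
    have "(\<lambda>n. exp (\<theta> * a) * exp (- u * real n)) \<longlonglongrightarrow> 0"
      using \<open>0 < u\<close> by real_asymp
    from LIMSEQ_Suc[OF this] have "(\<lambda>n. Y n \<omega>) \<longlonglongrightarrow> 0"
    proof (rule tendsto_sandwich[rotated -1])
      show "\<forall>\<^sub>F n in sequentially. Y n \<omega> \<le> exp (\<theta> * a) * exp (- u * real (Suc n))"
        unfolding Y_eq using level[OF \<omega>] by (auto simp: \<sigma>_eq)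
    qed (auto simp: Y_def)
    then show ?thesis using PInf by (simp add: L_def)
  qed (use T_nonneg[of \<omega>] in simp)
  have [measurable]: "Y n \<in> borel_measurable M" for n using Y by auto
  have meas: "(\<lambda>\<omega>. exp (\<theta> * a) * L \<omega>) \<in> borel_measurable M"
    using lim by (rule borel_measurable_LIMSEQ_real) auto
  have dom: "AE \<omega> in M. norm (Y n \<omega>) \<le> exp (\<theta> * a)" for n
    using bound by (intro AE_I2) (simp add: Y_def)
  have *: "integrable M (\<lambda>\<omega>. exp (\<theta> * a) * L \<omega>)"
    "(\<lambda>n. expectation (Y n)) \<longlonglongrightarrow> expectation (\<lambda>\<omega>. exp (\<theta> * a) * L \<omega>)"
    by (rule integrable_dominated_convergence[where w = "\<lambda>_. exp (\<theta> * a)" and s = Y]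
          integral_dominated_convergence[where w = "\<lambda>_. exp (\<theta> * a)"];
        use dom lim meas in \<open>auto intro: AE_I2\<close>)+
  show "integrable M L" using integrable_mult_right[OF *(1), of "exp (- \<theta> * a)"]
    by (simp add: mult.assoc[symmetric] exp_add[symmetric])
  have "expectation (\<lambda>\<omega>. exp (\<theta> * a) * L \<omega>) = 1"
    using *(2) by (simp add: Y LIMSEQ_const_iff)
  then show "expectation L = exp (- \<theta> * a)"
    by (simp add: exp_minus field_simps)
qed

end

section \<open>Poisson processes at an independent random time\<close>

context poisson_process
begin

lemma prob_eq:
  assumes "0 < rate" "0 < x"
  shows "prob {\<omega> \<in> space M. N x \<omega> = j} = exp (- rate * x) * (rate * x) ^ j / fact j"
proof -
  have [measurable]: "N x \<in> measurable M (count_space UNIV)" "N 0 \<in> measurable M (count_space UNIV)"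
    using assms by (auto intro: random_variable)
  have "(\<lambda>\<omega>. N x \<omega> - N 0 \<omega>) \<in> measurable M (count_space UNIV)"
    by measurable
  then have "measure (distr M (count_space UNIV) (\<lambda>\<omega>. N x \<omega> - N 0 \<omega>)) {j} = prob {\<omega> \<in> space M. N x \<omega> = j}"
    by (subst measure_distr) (auto simp: start intro!: arg_cong[where f = prob])
  then show ?thesis
    using poisson_increments[of 0 x] assms by (simp add: measure_pmf_single mult_ac)
qed

text \<open>In the discrete space of counts, convergence means being eventually constant.\<close>

lemma right_limit:
  assumes "\<omega> \<in> space M" "0 \<le> t" "filterlim X (at_right t) F"
  shows "\<forall>\<^sub>F n in F. N (X n) \<omega> = N t \<omega>"
proof -
  have "((\<lambda>s. N s \<omega>) \<longlongrightarrow> N t \<omega>) (at_right t)"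
    using right_continuous_paths[OF assms(1,2)] by (simp add: continuous_within)
  then have "\<forall>\<^sub>F s in at_right t. N s \<omega> = N t \<omega>" by (simp add: tendsto_discrete)
  with assms(3) show ?thesis unfolding filterlim_iff by blast
qed

text \<open>If the random time has countably many values, independence at fixed times suffices to
  sum over them. Discretising \<open>G\<close>, and then refining by dominated convergence on both
  sides, gives the general case.\<close>

lemma subordinated_prob_eq:
  fixes G :: "'a \<Rightarrow> ereal" and j :: nat
  assumes rate: "0 < rate" and [measurable]: "G \<in> borel_measurable M"
    and nonneg: "\<And>\<omega>. \<omega> \<in> space M \<Longrightarrow> 0 \<le> G \<omega>"
    and indep: "\<And>x S. 0 < x \<Longrightarrow> S \<in> sets borel \<Longrightarrow>
      prob ({\<omega> \<in> space M. N x \<omega> = j} \<inter> (G -` S \<inter> space M)) =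
      prob {\<omega> \<in> space M. N x \<omega> = j} * prob (G -` S \<inter> space M)"
  defines "w \<equiv> \<lambda>x. exp (- rate * x) * (rate * x) ^ j / fact j"
  shows "prob {\<omega> \<in> space M. \<exists>s. G \<omega> = ereal s \<and> N s \<omega> = j} =
    expectation (\<lambda>\<omega>. if G \<omega> = \<infinity> then 0 else w (real_of_ereal (G \<omega>)))"
proof -
  \<comment> \<open>\<open>G\<close> is approximated strictly from above by \<open>x n (I n G)\<close>, so that right continuity of \<open>N\<close> applies.\<close>
  define I where "I n y = nat \<lfloor>real (Suc n) * real_of_ereal y\<rfloor>" for n y
  define x where "x n i = real (Suc i) / real (Suc n)" for n i :: nat
  \<comment> \<open>Since \<open>real_of_ereal \<infinity>\<close> is 0, infinity would otherwise
    fall into cell 0.\<close>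
  define S where "S n i = {y. y \<noteq> \<infinity> \<and> I n y = i}" for n i
  define F where "F n i = G -` S n i \<inter> space M" for n i
  define A where "A n = (\<Union>i. {\<omega> \<in> space M. N (x n i) \<omega> = j} \<inter> F n i)" for n
  let ?E = "{\<omega> \<in> space M. \<exists>s. G \<omega> = ereal s \<and> N s \<omega> = j}"
  have x_pos: "0 < x n i" for n i by (simp add: x_def)
  have S: "S n i \<in> sets borel" for n i
  proof -
    have "Measurable.pred borel (\<lambda>y. y \<noteq> \<infinity> \<and> I n y = i)" unfolding I_def by measurable
    then show ?thesis by (simp add: S_def pred_def)
  qed
  have F: "F n i \<in> events" for n i unfolding F_def using S by measurable
  have N_event: "{\<omega> \<in> space M. N (x n i) \<omega> = j} \<in> events" for n i
  proof -
    have [measurable]: "N (x n i) \<in> measurable M (count_space UNIV)"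
      using x_pos by (intro random_variable less_imp_le)
    show ?thesis by measurable
  qed
  have A: "A n \<in> events" for n
    unfolding A_def using F N_event by (intro sets.countable_UN) auto
  have disj: "disjoint_family (F n)" for n
    unfolding disjoint_family_on_def F_def S_def by auto
  have w_nonneg: "0 \<le> w (x n i)" for n i using x_pos[of n i] rate by (simp add: w_def)
  \<comment> \<open>The weight is a Poisson probability; this gives the constant majorant for both
    limits.\<close>
  have w_le: "w y \<le> 1" if "0 < y" for y
    using prob_eq[OF rate that, of j] prob_le_1 unfolding w_def by metis
  define h where "h n \<omega> = (if G \<omega> = \<infinity> then 0 else w (x n (I n (G \<omega>))))" for n \<omega>
  have h_meas [measurable]: "h n \<in> borel_measurable M" for n
    unfolding h_def w_def x_def I_def by measurable
  have h_bound: "0 \<le> h n \<omega>" "h n \<omega> \<le> 1" for n \<omega>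
    using w_nonneg w_le x_pos by (auto simp: h_def)
  have h_int: "integrable M (h n)" for n
    using h_bound by (intro integrable_const_bound[where B = 1]) auto
  \<comment> \<open>The cells \<open>F n i\<close> are disjoint, so probabilities add up, and on
    each cell the time is the constant \<open>x n i\<close>, so independence factors the
    term.\<close>
  have step: "prob (A n) = expectation (h n)" for n
  proof -
    have h_eq: "ennreal (h n \<omega>) = (\<Sum>i. ennreal (w (x n i)) * indicator (F n i) \<omega>)" if "\<omega> \<in> space M" for \<omega>
    proof (cases "G \<omega> = \<infinity>")
      case True
      then show ?thesis by (simp add: h_def F_def S_def)
    next
      case False
      then have "\<omega> \<in> F n (I n (G \<omega>))" using that by (simp add: F_def S_def)
      from suminf_cmult_indicator[OF disj this] False show ?thesis by (simp add: h_def)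
    qed
    have "emeasure M (A n) = (\<Sum>i. emeasure M ({\<omega> \<in> space M. N (x n i) \<omega> = j} \<inter> F n i))"
      unfolding A_def using F N_event
      by (intro suminf_emeasure[symmetric]) (auto intro: disjoint_family_subset[OF disj])
    also have "\<dots> = (\<Sum>i. ennreal (w (x n i)) * emeasure M (F n i))"
    proof (rule suminf_cong)
      fix i
      have "prob ({\<omega> \<in> space M. N (x n i) \<omega> = j} \<inter> F n i) = w (x n i) * prob (F n i)"
        unfolding F_def w_def indep[OF x_pos S] prob_eq[OF rate x_pos] ..
      then show "emeasure M ({\<omega> \<in> space M. N (x n i) \<omega> = j} \<inter> F n i) = ennreal (w (x n i)) * emeasure M (F n i)"
        by (simp add: emeasure_eq_measure ennreal_mult w_nonneg)
    qed
    also have "\<dots> = (\<Sum>i. \<integral>\<^sup>+\<omega>. ennreal (w (x n i)) * indicator (F n i) \<omega> \<partial>M)"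
      using F by (simp add: nn_integral_cmult_indicator)
    also have "\<dots> = (\<integral>\<^sup>+\<omega>. (\<Sum>i. ennreal (w (x n i)) * indicator (F n i) \<omega>) \<partial>M)"
      using F by (intro nn_integral_suminf[symmetric]) auto
    also have "\<dots> = (\<integral>\<^sup>+\<omega>. ennreal (h n \<omega>) \<partial>M)"
      using h_eq by (intro nn_integral_cong) simp
    also have "\<dots> = ennreal (expectation (h n))"
      using h_int h_bound by (intro nn_integral_eq_integral) auto
    finally show ?thesis
      using h_bound by (simp add: emeasure_eq_measure)
  qed
  have x_lim: "filterlim (\<lambda>n. x n (I n (ereal s))) (at_right s) sequentially" if "0 \<le> s" for s
  proof -
    \<comment> \<open>The successor in \<open>x\<close> moves the rounded-down time strictly past
      \<open>s\<close>, by at most one mesh width; \<open>at_right s\<close> demands the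
      strictness.\<close>
    have b: "s < x n (I n (ereal s)) \<and> x n (I n (ereal s)) \<le> s + 1 / real (Suc n)" for n
    proof -
      define c where "c = real (Suc n)"
      define i where "i = real (I n (ereal s))"
      have "0 < c" by (simp add: c_def)
      have "i = of_int \<lfloor>c * s\<rfloor>"
        using that \<open>0 < c\<close> by (simp add: i_def I_def c_def[symmetric] del: of_nat_Suc)
      then have "i \<le> c * s" "c * s < i + 1" by simp_all
      then have "s < (i + 1) / c" "(i + 1) / c \<le> s + 1 / c"
        using \<open>0 < c\<close> by (simp_all add: field_simps)
      moreover have "x n (I n (ereal s)) = (i + 1) / c"
        by (simp add: x_def i_def c_def)
      ultimately show ?thesis by (simp add: c_def)
    qed
    have "(\<lambda>n. s + 1 / real (Suc n)) \<longlonglongrightarrow> s + 0"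
      by (intro tendsto_add tendsto_const LIMSEQ_Suc[OF lim_const_over_n])
    then have "(\<lambda>n. s + 1 / real (Suc n)) \<longlonglongrightarrow> s" by simp
    then have "(\<lambda>n. x n (I n (ereal s))) \<longlonglongrightarrow> s"
      by (rule tendsto_sandwich[where f = "\<lambda>_. s", rotated -1])
         (use b in \<open>simp_all add: less_imp_le\<close>)
    moreover have "x n (I n (ereal s)) \<in> {s<..} \<and> x n (I n (ereal s)) \<noteq> s" for n
      using b[of n] by auto
    ultimately show ?thesis
      unfolding filterlim_at by simp
  qed
  have lim_A: "(\<lambda>n. indicator (A n) \<omega>) \<longlonglongrightarrow> (indicator ?E \<omega> :: real)" if \<omega>: "\<omega> \<in> space M" for \<omega>
  proof (cases "G \<omega>")
    case (real s)
    then have "0 \<le> s" using nonneg[OF \<omega>] by simp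
    from right_limit[OF \<omega> this x_lim[OF this]]
    have "\<forall>\<^sub>F n in sequentially. (indicator (A n) \<omega> :: real) = indicator ?E \<omega>"
      using \<omega> by (auto simp: A_def F_def S_def real indicator_def elim!: eventually_mono)
    then show ?thesis by (rule tendsto_eventually)
  qed (use nonneg[OF \<omega>] in \<open>auto simp: A_def F_def S_def indicator_def\<close>)
  have lim_h: "(\<lambda>n. h n \<omega>) \<longlonglongrightarrow> (if G \<omega> = \<infinity> then 0 else w (real_of_ereal (G \<omega>)))"
    if \<omega>: "\<omega> \<in> space M" for \<omega>
  proof (cases "G \<omega>")
    case (real s)
    then have "0 \<le> s" using nonneg[OF \<omega>] by simp
    then have "(\<lambda>n. x n (I n (ereal s))) \<longlonglongrightarrow> s" using x_lim by (simp add: filterlim_at)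
    then have "(\<lambda>n. w (x n (I n (ereal s)))) \<longlonglongrightarrow> w s"
      unfolding w_def by (intro tendsto_intros) simp_all
    then show ?thesis by (simp add: h_def real)
  qed (use nonneg[OF \<omega>] in \<open>auto simp: h_def\<close>)
  have indicator_A: "(\<lambda>\<omega>. indicator (A n) \<omega> :: real) \<in> borel_measurable M" for n
    using A by (rule borel_measurable_indicator)
  have "(\<lambda>n. expectation (\<lambda>\<omega>. indicator (A n) \<omega>)) \<longlonglongrightarrow> (expectation (\<lambda>\<omega>. indicator ?E \<omega>) :: real)"
  proof (rule integral_dominated_convergence[where w = "\<lambda>_. 1"])
    show "(\<lambda>\<omega>. indicator ?E \<omega> :: real) \<in> borel_measurable M"
      using lim_A indicator_A by (rule borel_measurable_LIMSEQ_real)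
    show "AE \<omega> in M. (\<lambda>n. indicator (A n) \<omega>) \<longlonglongrightarrow> (indicator ?E \<omega> :: real)"
      using lim_A by (rule AE_I2)
    show "AE \<omega> in M. norm (indicator (A n) \<omega> :: real) \<le> 1" for n
      by (rule AE_I2) (simp add: indicator_def)
  qed (use indicator_A in simp_all)
  moreover have "expectation (\<lambda>\<omega>. indicator (A n) \<omega>) = expectation (h n)" for n
    using A by (simp add: step Int_absorb2 sets.sets_into_space)
  moreover have "(\<lambda>n. expectation (h n)) \<longlonglongrightarrow>
      expectation (\<lambda>\<omega>. if G \<omega> = \<infinity> then 0 else w (real_of_ereal (G \<omega>)))"
  proof (rule integral_dominated_convergence[where w = "\<lambda>_. 1"])
    show "AE \<omega> in M. (\<lambda>n. h n \<omega>) \<longlonglongrightarrow> (if G \<omega> = \<infinity> then 0 else w (real_of_ereal (G \<omega>)))"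
      using lim_h by (rule AE_I2)
    show "AE \<omega> in M. norm (h n \<omega>) \<le> 1" for n
      using h_bound by (intro AE_I2) simp
    show "(\<lambda>\<omega>. if G \<omega> = \<infinity> then 0 else w (real_of_ereal (G \<omega>))) \<in> borel_measurable M"
      unfolding w_def by measurable
  qed simp_all
  ultimately have "expectation (\<lambda>\<omega>. indicator ?E \<omega>) =
      expectation (\<lambda>\<omega>. if G \<omega> = \<infinity> then 0 else w (real_of_ereal (G \<omega>)))"
    by (simp add: LIMSEQ_unique)
  then show ?thesis by (simp add: Int_absorb2 subset_eq)
qed

end

section \<open>Moments of the inverse Gaussian law\<close>

text \<open>Taylor remainder for differentiation under the expectation. Both bounds come from
  \<open>1 + y \<le> exp y\<close>, applied at \<open>y\<close> and at \<open>- y\<close>.\<close>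

lemma exp_minus_linear_bounds:
  fixes y :: real
  shows "0 \<le> exp y - 1 - y" and "exp y - 1 - y \<le> y\<^sup>2 * exp \<bar>y\<bar>"
proof -
  show "0 \<le> exp y - 1 - y" using exp_ge_add_one_self[of y] by linarith
  have "exp y * (1 - y) \<le> exp y * exp (- y)"
    using exp_ge_add_one_self[of "- y"] by (intro mult_left_mono) auto
  then have *: "exp y - 1 \<le> y * exp y" by (simp add: exp_minus algebra_simps)
  show "exp y - 1 - y \<le> y\<^sup>2 * exp \<bar>y\<bar>"
  proof (cases "0 \<le> y")
    case True
    have "exp y - 1 - y \<le> y * (exp y - 1)" using * by (simp add: algebra_simps)
    also have "\<dots> \<le> y * (y * exp y)" using True * by (intro mult_left_mono) auto
    finally show ?thesis using True by (simp add: power2_eq_square mult.assoc)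
  next
    case False
    have "exp y - 1 - y \<le> y * (exp y - 1)" using * by (simp add: algebra_simps)
    also have "\<dots> \<le> y * y"
    proof (rule mult_left_mono_neg)
      show "y \<le> exp y - 1" using exp_ge_add_one_self[of y] by linarith
    qed (use False in simp)
    also have "\<dots> \<le> y\<^sup>2 * exp \<bar>y\<bar>" by (simp add: power2_eq_square mult_le_cancel_left1)
    finally show ?thesis .
  qed
qed

text \<open>A single term of the exponential series is at most its sum. This makes the integrands of
  \<open>laplace_moment\<close> bounded.\<close>

lemma power_times_exp_bound:
  fixes u z :: real
  assumes "0 < u" "0 \<le> z"
  shows "z ^ k * exp (- u * z) \<le> fact k / u ^ k"
proof -
  have "(\<Sum>n\<in>{k}. inverse (fact n) * (u * z) ^ n) \<le> (\<Sum>n. inverse (fact n) * (u * z) ^ n)"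
    using assms summable_exp[of "u * z"] by (intro sum_le_suminf) auto
  then have "(u * z) ^ k \<le> fact k * exp (u * z)"
    by (simp add: exp_def scaleR_conv_of_real field_simps)
  then have "u ^ k * z ^ k \<le> fact k * exp (u * z)" by (simp add: power_mult_distrib)
  then show ?thesis using assms by (simp add: exp_minus field_simps)
qed

lemma DERIV_of_quadratic_error:
  fixes f :: "real \<Rightarrow> real"
  assumes "0 < d" and err: "\<And>v. \<bar>v - u\<bar> \<le> d \<Longrightarrow> \<bar>f v - f u - D * (v - u)\<bar> \<le> C * (v - u)\<^sup>2"
  shows "(f has_real_derivative D) (at u)"
proof -
  have "((\<lambda>v. (f v - f u) / (v - u) - D) \<longlongrightarrow> 0) (at u)"
  proof (rule Lim_null_comparison)
    have "\<forall>\<^sub>F v in at u. \<bar>v - u\<bar> < d \<and> v \<noteq> u"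
      using \<open>0 < d\<close> by (auto simp: eventually_at dist_real_def)
    then show "\<forall>\<^sub>F v in at u. norm ((f v - f u) / (v - u) - D) \<le> C * \<bar>v - u\<bar>"
    proof eventually_elim
      case (elim v)
      then have "(f v - f u) / (v - u) - D = (f v - f u - D * (v - u)) / (v - u)"
        by (simp add: field_simps)
      then have "norm ((f v - f u) / (v - u) - D) = \<bar>f v - f u - D * (v - u)\<bar> / \<bar>v - u\<bar>"
        by (simp add: abs_divide)
      also have "\<dots> \<le> C * (v - u)\<^sup>2 / \<bar>v - u\<bar>"
        using err[of v] elim by (intro divide_right_mono) auto
      also have "\<dots> = C * \<bar>v - u\<bar>"
        using elim by (simp add: field_simps power2_eq_square abs_if)
      finally show ?case .
    qed
    show "((\<lambda>v. C * \<bar>v - u\<bar>) \<longlongrightarrow> 0) (at u)"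
      by (auto intro!: tendsto_eq_intros)
  qed
  then show ?thesis by (simp add: has_field_derivative_iff LIM_zero_iff)
qed

context prob_space
begin

text \<open>For \<open>u > 0\<close> the value 0 at infinity is the limit of the integrand, and it
  agrees with \<open>subordinated_prob\<close>, where infinite times contribute nothing.\<close>

definition laplace_moment :: "('a \<Rightarrow> ereal) \<Rightarrow> nat \<Rightarrow> real \<Rightarrow> real" where
  "laplace_moment Z k u = expectation (\<lambda>\<omega>. if Z \<omega> = \<infinity> then 0
     else real_of_ereal (Z \<omega>) ^ k * exp (- u * real_of_ereal (Z \<omega>)))"

text \<open>The remainder of the exponential costs a factor \<open>exp \<bar>y\<bar>\<close>. For
  \<open>\<bar>v - u\<bar> \<le> u / 2\<close> half of the decay rate \<open>u\<close> absorbs it,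
  leaving the integrand of order \<open>k + 2\<close> at \<open>u / 2\<close> as a majorant for the
  quadratic error.\<close>

lemma laplace_moment_DERIV:
  assumes [measurable]: "Z \<in> borel_measurable M"
    and nonneg: "\<And>\<omega>. \<omega> \<in> space M \<Longrightarrow> 0 \<le> Z \<omega>" and u: "0 < u"
  shows "(laplace_moment Z k has_real_derivative - laplace_moment Z (Suc k) u) (at u)"
proof -
  define h where "h k u \<omega> = (if Z \<omega> = \<infinity> then 0
     else real_of_ereal (Z \<omega>) ^ k * exp (- u * real_of_ereal (Z \<omega>)))" for k u \<omega>
  have [measurable]: "h k u \<in> borel_measurable M" for k u unfolding h_def by measurable
  have z: "0 \<le> real_of_ereal (Z \<omega>)" if "\<omega> \<in> space M" for \<omega>
    using nonneg[OF that] by (cases "Z \<omega>") auto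
  have int: "integrable M (h k v)" if "0 < v" for k v
  proof (rule integrable_const_bound[where B = "fact k / v ^ k"])
    show "AE \<omega> in M. norm (h k v \<omega>) \<le> fact k / v ^ k"
      using z power_times_exp_bound[OF that] that by (intro AE_I2) (auto simp: h_def)
  qed measurable
  have lm: "laplace_moment Z k v = expectation (h k v)" for k v
    unfolding laplace_moment_def by (intro Bochner_Integration.integral_cong) (simp_all add: h_def)
  define C where "C = laplace_moment Z (k + 2) (u / 2)"
  have err: "\<bar>h k v \<omega> - h k u \<omega> + h (Suc k) u \<omega> * (v - u)\<bar> \<le> h (k + 2) (u / 2) \<omega> * (v - u)\<^sup>2"
    if v: "\<bar>v - u\<bar> \<le> u / 2" and \<omega>: "\<omega> \<in> space M" for v \<omega>
  proof (cases "Z \<omega> = \<infinity>")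
    case False
    define x where "x = real_of_ereal (Z \<omega>)"
    define y where "y = - (v - u) * x"
    have "0 \<le> x" using z[OF \<omega>] by (simp add: x_def)
    have "\<bar>y\<bar> = \<bar>v - u\<bar> * x" using \<open>0 \<le> x\<close> by (simp add: y_def abs_mult abs_minus_commute)
    also have "\<dots> \<le> u / 2 * x" using v \<open>0 \<le> x\<close> by (intro mult_right_mono)
    finally have y: "\<bar>y\<bar> \<le> u / 2 * x" .
    have "h k v \<omega> - h k u \<omega> + h (Suc k) u \<omega> * (v - u) = x ^ k * exp (- u * x) * (exp y - 1 - y)"
    proof -
      have "exp (- v * x) = exp (- u * x) * exp y"
        unfolding exp_add[symmetric] y_def by (simp add: algebra_simps)
      then show ?thesis using False unfolding h_def x_def[symmetric]
        by (simp add: algebra_simps y_def)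
    qed
    then have "\<bar>h k v \<omega> - h k u \<omega> + h (Suc k) u \<omega> * (v - u)\<bar> = x ^ k * exp (- u * x) * (exp y - 1 - y)"
      using \<open>0 \<le> x\<close> exp_minus_linear_bounds(1)[of y] by (simp add: abs_mult)
    also have "\<dots> \<le> x ^ k * exp (- u * x) * (y\<^sup>2 * exp (u / 2 * x))"
    proof (rule mult_left_mono)
      show "exp y - 1 - y \<le> y\<^sup>2 * exp (u / 2 * x)"
        using y by (intro order_trans[OF exp_minus_linear_bounds(2)] mult_left_mono) auto
    qed (use \<open>0 \<le> x\<close> in simp)
    also have "\<dots> = x ^ k * y\<^sup>2 * (exp (- u * x) * exp (u / 2 * x))"
      by (simp only: mult_ac)
    also have "exp (- u * x) * exp (u / 2 * x) = exp (- (u / 2) * x)"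
      unfolding exp_add[symmetric] by (simp add: field_simps)
    also have "y\<^sup>2 = (v - u)\<^sup>2 * x\<^sup>2"
      by (simp add: y_def power_mult_distrib power2_commute)
    also have "x ^ k * ((v - u)\<^sup>2 * x\<^sup>2) * exp (- (u / 2) * x) = h (k + 2) (u / 2) \<omega> * (v - u)\<^sup>2"
      using False unfolding h_def x_def[symmetric] by (simp add: power_add power2_eq_square mult_ac)
    finally show ?thesis .
  qed (simp add: h_def)
  show ?thesis
  proof (rule DERIV_of_quadratic_error[where C = C])
    show "0 < u / 2" using u by simp
    fix v assume v: "\<bar>v - u\<bar> \<le> u / 2"
    then have "0 < v" using u by linarith
    note ints = int[OF \<open>0 < v\<close>] int[OF u]
    have "laplace_moment Z k v - laplace_moment Z k u - - laplace_moment Z (Suc k) u * (v - u)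
        = expectation (\<lambda>\<omega>. h k v \<omega> - h k u \<omega> + h (Suc k) u \<omega> * (v - u))"
      unfolding lm using ints by simp
    also have "\<bar>\<dots>\<bar> \<le> expectation (\<lambda>\<omega>. \<bar>h k v \<omega> - h k u \<omega> + h (Suc k) u \<omega> * (v - u)\<bar>)"
      by (rule integral_abs_bound)
    also have "\<dots> \<le> expectation (\<lambda>\<omega>. h (k + 2) (u / 2) \<omega> * (v - u)\<^sup>2)"
      using ints int[of "u / 2"] u err[OF v] by (intro integral_mono) auto
    also have "\<dots> = C * (v - u)\<^sup>2" by (simp add: C_def lm)
    finally show "\<bar>laplace_moment Z k v - laplace_moment Z k u - - laplace_moment Z (Suc k) u * (v - u)\<bar>
      \<le> C * (v - u)\<^sup>2" .
  qed
qed

end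

section \<open>Recurrence and differential equations for the moments\<close>

text \<open>Isolates the two probabilistic inputs; everything derived from them here is
  calculus.\<close>

locale inverse_gaussian_moments =
  fixes F :: "nat \<Rightarrow> real \<Rightarrow> real \<Rightarrow> real" and \<delta> \<gamma> :: real
  assumes moment_DERIV: "\<lbrakk>0 < t; 0 < u\<rbrakk> \<Longrightarrow> (F k t has_real_derivative - F (Suc k) t u) (at u)"
    and laplace: "\<lbrakk>0 < t; 0 < u\<rbrakk> \<Longrightarrow> F 0 t u = exp (- (sqrt (\<gamma>\<^sup>2 + 2 * u) - \<gamma>) * (\<delta> * t))"
begin

lemma radicand_pos: "0 < u \<Longrightarrow> 0 < \<gamma>\<^sup>2 + 2 * u"
  by (simp add: add_nonneg_pos)

text \<open>Two expressions for the derivative of \<open>F 0 t\<close> in \<open>u\<close>: from the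
  closed form and from \<open>moment_DERIV\<close>.\<close>

lemma first_moment:
  assumes "0 < t" "0 < u"
  shows "F 1 t u = \<delta> * t / sqrt (\<gamma>\<^sup>2 + 2 * u) * F 0 t u"
proof -
  have "((\<lambda>u. exp (- (sqrt (\<gamma>\<^sup>2 + 2 * u) - \<gamma>) * (\<delta> * t))) has_real_derivative
      - (\<delta> * t / sqrt (\<gamma>\<^sup>2 + 2 * u) * F 0 t u)) (at u)"
    using assms radicand_pos[OF assms(2)]
    by (auto simp: laplace field_simps intro!: derivative_eq_intros)
  then have "(F 0 t has_real_derivative - (\<delta> * t / sqrt (\<gamma>\<^sup>2 + 2 * u) * F 0 t u)) (at u)"
    by (rule has_field_derivative_transform_within_open[where S = "{0<..}"]) (use assms laplace in auto)
  with moment_DERIV[OF assms, of 0] show ?thesis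
    using DERIV_unique by fastforce
qed

text \<open>The three-term recurrence of modified Bessel functions of half-integer order.
  Differentiating the identity in \<open>u\<close> raises \<open>k\<close> by one; the derivative of
  \<open>\<gamma>\<^sup>2 + 2 * u\<close> turns the coefficient \<open>2 * k + 1\<close> into
  \<open>2 * k + 3\<close>. The identity is thus needed for all positive \<open>u\<close> at
  once.\<close>

lemma moment_recurrence:
  assumes "0 < t" "0 < u"
  shows "(\<gamma>\<^sup>2 + 2 * u) * F (Suc (Suc k)) t u - (2 * real k + 1) * F (Suc k) t u = \<delta>\<^sup>2 * t\<^sup>2 * F k t u"
  using assms(2)
proof (induction k arbitrary: u)
  case 0
  define r where "r = sqrt (\<gamma>\<^sup>2 + 2 * u)"
  have r: "0 < r" "r\<^sup>2 = \<gamma>\<^sup>2 + 2 * u" using radicand_pos[OF 0] by (auto simp: r_def)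
  have "((\<lambda>u. sqrt (\<gamma>\<^sup>2 + 2 * u)) has_real_derivative 1 / r) (at u)"
    using radicand_pos[OF 0] unfolding r_def by (auto intro!: derivative_eq_intros simp: field_simps)
  from DERIV_divide[OF DERIV_const[of "\<delta> * t"] this]
  have "((\<lambda>u. \<delta> * t / sqrt (\<gamma>\<^sup>2 + 2 * u)) has_real_derivative - \<delta> * t / r ^ 3) (at u)"
    using r(1) by (simp add: r_def[symmetric] power3_eq_cube mult.assoc)
  from DERIV_mult[OF this moment_DERIV[OF assms(1) 0, of 0]]
  have "((\<lambda>u. \<delta> * t / sqrt (\<gamma>\<^sup>2 + 2 * u) * F 0 t u) has_real_derivative
      - \<delta> * t / r ^ 3 * F 0 t u - \<delta> * t / r * F 1 t u) (at u)"
    by (rule DERIV_cong, unfold r_def[symmetric]) (simp add: mult_ac)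
  then have "(F 1 t has_real_derivative - \<delta> * t / r ^ 3 * F 0 t u - \<delta> * t / r * F 1 t u) (at u)"
    by (rule has_field_derivative_transform_within_open[where S = "{0<..}"])
       (use assms 0 first_moment in auto)
  from DERIV_unique[OF moment_DERIV[OF assms(1) 0, of 1, simplified] this[simplified]]
  have F2: "F (Suc (Suc 0)) t u = \<delta> * t / r ^ 3 * F 0 t u + \<delta> * t / r * F 1 t u" by (simp add: numeral_2_eq_2)
  have F1: "F 1 t u = \<delta> * t / r * F 0 t u" using first_moment[OF assms(1) 0] by (simp add: r_def)
  show ?case unfolding r(2)[symmetric] F2 using F1 r(1)
    by (simp add: field_simps power2_eq_square power3_eq_cube)
next
  case (Suc k)
  have "((\<lambda>u. (\<gamma>\<^sup>2 + 2 * u) * F (Suc (Suc k)) t u - (2 * real k + 1) * F (Suc k) t u) has_real_derivative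
      2 * F (Suc (Suc k)) t u + (\<gamma>\<^sup>2 + 2 * u) * (- F (Suc (Suc (Suc k))) t u)
      - (2 * real k + 1) * (- F (Suc (Suc k)) t u)) (at u)"
    by (auto intro!: derivative_eq_intros moment_DERIV[OF assms(1) Suc.prems])
  then have "((\<lambda>u. \<delta>\<^sup>2 * t\<^sup>2 * F k t u) has_real_derivative
      2 * F (Suc (Suc k)) t u + (\<gamma>\<^sup>2 + 2 * u) * (- F (Suc (Suc (Suc k))) t u)
      - (2 * real k + 1) * (- F (Suc (Suc k)) t u)) (at u)"
    by (rule has_field_derivative_transform_within_open[where S = "{0<..}"]) (use Suc in auto)
  moreover have "((\<lambda>u. \<delta>\<^sup>2 * t\<^sup>2 * F k t u) has_real_derivative \<delta>\<^sup>2 * t\<^sup>2 * - F (Suc k) t u) (at u)"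
    by (intro DERIV_cmult moment_DERIV[OF assms(1) Suc.prems])
  ultimately have "2 * F (Suc (Suc k)) t u + (\<gamma>\<^sup>2 + 2 * u) * (- F (Suc (Suc (Suc k))) t u)
      - (2 * real k + 1) * (- F (Suc (Suc k)) t u) = \<delta>\<^sup>2 * t\<^sup>2 * - F (Suc k) t u"
    by (rule DERIV_unique)
  then show ?case by (simp add: algebra_simps)
qed

text \<open>The time derivative of \<open>F k\<close>, as \<open>time_DERIV\<close> shows; the
  explicit form in \<open>F k\<close> and \<open>F (Suc k)\<close> allows a second
  differentiation.\<close>

definition dF :: "nat \<Rightarrow> real \<Rightarrow> real \<Rightarrow> real" where
  "dF k t u = \<delta> * \<gamma> * F k t u - ((\<gamma>\<^sup>2 + 2 * u) * F (Suc k) t u - 2 * real k * F k t u) / t"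

lemma time_DERIV:
  assumes "0 < t" "0 < u"
  shows "((\<lambda>t. F k t u) has_real_derivative dF k t u) (at t)"
proof -
  define R where "R = \<gamma>\<^sup>2 + 2 * u"
  define r where "r = sqrt R"
  have R: "0 < R" using radicand_pos[OF assms(2)] by (simp add: R_def)
  then have r: "0 < r" "R = r * r" by (auto simp: r_def)
  note rec = moment_recurrence[OF _ assms(2), folded R_def]
  \<comment> \<open>The recurrence reaches back two indices, so the induction carries two
    consecutive ones.\<close>
  have "((\<lambda>t. F k t u) has_real_derivative dF k t u) (at t) \<and>
        ((\<lambda>t. F (Suc k) t u) has_real_derivative dF (Suc k) t u) (at t)"
  proof (induction k)
    case 0
    have F1: "F 1 s u = \<delta> * s / r * F 0 s u" if "0 < s" for s
      using first_moment[OF that assms(2)] by (simp add: r_def R_def)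
    have "((\<lambda>s. exp (- (r - \<gamma>) * (\<delta> * s))) has_real_derivative - (r - \<gamma>) * \<delta> * F 0 t u) (at t)"
      by (auto intro!: derivative_eq_intros simp: laplace[OF assms] r_def R_def)
    then have "((\<lambda>s. F 0 s u) has_real_derivative - (r - \<gamma>) * \<delta> * F 0 t u) (at t)"
      by (rule has_field_derivative_transform_within_open[where S = "{0<..}"])
         (use assms laplace in \<open>auto simp: r_def R_def\<close>)
    also have "- (r - \<gamma>) * \<delta> * F 0 t u = dF 0 t u"
    proof -
      have "R * F (Suc 0) t u = \<delta> * t * r * F 0 t u" using F1[OF assms(1)] r by simp
      then show ?thesis unfolding dF_def R_def[symmetric] using assms(1) by (simp add: field_simps)
    qed
    finally have D0: "((\<lambda>s. F 0 s u) has_real_derivative dF 0 t u) (at t)" .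
    have "((\<lambda>s. \<delta> * s / r * F 0 s u) has_real_derivative \<delta> / r * F 0 t u + \<delta> * t / r * dF 0 t u) (at t)"
      using r by (auto intro!: derivative_eq_intros D0 simp: add_divide_distrib mult_ac)
    then have "((\<lambda>s. F 1 s u) has_real_derivative \<delta> / r * F 0 t u + \<delta> * t / r * dF 0 t u) (at t)"
      by (rule has_field_derivative_transform_within_open[where S = "{0<..}"])
         (use assms F1 in auto)
    also have "\<delta> / r * F 0 t u + \<delta> * t / r * dF 0 t u = dF 1 t u"
    proof -
      have "R * F (Suc (Suc 0)) t u = F 1 t u + \<delta>\<^sup>2 * t\<^sup>2 * F 0 t u" using rec[OF assms(1), of 0] by simp
      then show ?thesis
        unfolding dF_def One_nat_def[symmetric] R_def[symmetric] using F1[OF assms(1)] r assms(1)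
        by (simp add: field_simps power2_eq_square)
    qed
    finally show ?case using D0 by simp
  next
    case (Suc k)
    then have Dk: "((\<lambda>t. F k t u) has_real_derivative dF k t u) (at t)"
      and Dk1: "((\<lambda>t. F (Suc k) t u) has_real_derivative dF (Suc k) t u) (at t)" by auto
    have F2: "F (Suc (Suc k)) s u = ((2 * real k + 1) * F (Suc k) s u + \<delta>\<^sup>2 * s\<^sup>2 * F k s u) / R" if "0 < s" for s k
      using rec[OF that, of k] R by (simp add: field_simps)
    have "((\<lambda>s. ((2 * real k + 1) * F (Suc k) s u + \<delta>\<^sup>2 * s\<^sup>2 * F k s u) / R) has_real_derivative
       ((2 * real k + 1) * dF (Suc k) t u + \<delta>\<^sup>2 * (2 * t) * F k t u + \<delta>\<^sup>2 * t\<^sup>2 * dF k t u) / R) (at t)"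
      using R by (auto intro!: derivative_eq_intros Dk Dk1 simp: field_simps)
    then have "((\<lambda>s. F (Suc (Suc k)) s u) has_real_derivative
       ((2 * real k + 1) * dF (Suc k) t u + \<delta>\<^sup>2 * (2 * t) * F k t u + \<delta>\<^sup>2 * t\<^sup>2 * dF k t u) / R) (at t)"
      by (rule has_field_derivative_transform_within_open[where S = "{0<..}"])
         (use assms F2 in auto)
    \<comment> \<open>The recurrence at \<open>k\<close> and \<open>Suc k\<close> reduces both sides
      to \<open>F k\<close> and \<open>F (Suc k)\<close>, where they agree as rational
      expressions.\<close>
    also have "((2 * real k + 1) * dF (Suc k) t u + \<delta>\<^sup>2 * (2 * t) * F k t u + \<delta>\<^sup>2 * t\<^sup>2 * dF k t u) / R
       = dF (Suc (Suc k)) t u"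
      unfolding dF_def R_def[symmetric] F2[OF assms(1), of k] F2[OF assms(1), of "Suc k"]
      using R assms(1) by (simp add: field_simps power2_eq_square) 
    finally show ?case using Dk1 by simp
  qed
  then show ?thesis ..
qed

text \<open>Differentiating \<open>dF k\<close> produces \<open>dF (Suc k)\<close> and with it
  \<open>F (k + 2)\<close>. The recurrence at \<open>k\<close> removes the latter, and the one at
  \<open>k - 1\<close> exchanges \<open>F (k + 1)\<close> for \<open>F (k - 1)\<close>.\<close>

lemma time_ODE:
  assumes "0 < t" "0 < u"
  shows "((\<lambda>t. dF k t u) has_real_derivative
    2 * \<delta> * \<gamma> * dF k t u + 2 * \<delta>\<^sup>2 * (u * F k t u - real k * F (k - 1) t u)) (at t)"
proof -
  define R where "R = \<gamma>\<^sup>2 + 2 * u"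
  have "((\<lambda>t. dF k t u) has_real_derivative
      \<delta> * \<gamma> * dF k t u - (R * dF (Suc k) t u - 2 * real k * dF k t u) / t
      + (R * F (Suc k) t u - 2 * real k * F k t u) / t\<^sup>2) (at t)"
    unfolding dF_def[of k] R_def using assms(1)
    by (auto intro!: derivative_eq_intros time_DERIV assms simp: dF_def[of k] field_simps power2_eq_square)
  also have "\<delta> * \<gamma> * dF k t u - (R * dF (Suc k) t u - 2 * real k * dF k t u) / t
      + (R * F (Suc k) t u - 2 * real k * F k t u) / t\<^sup>2 =
      2 * \<delta> * \<gamma> * dF k t u + 2 * \<delta>\<^sup>2 * (u * F k t u - real k * F (k - 1) t u)"
  proof -
    have F2: "R * F (Suc (Suc k)) t u = (2 * real k + 1) * F (Suc k) t u + \<delta>\<^sup>2 * t\<^sup>2 * F k t u"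
      using moment_recurrence[OF assms, of k] by (simp add: R_def)
    \<comment> \<open>The factor \<open>real k\<close> keeps this true for \<open>k = 0\<close>,
      where \<open>k - 1\<close> is 0.\<close>
    have F0: "real k * (\<delta>\<^sup>2 * t\<^sup>2 * F (k - 1) t u) = real k * (R * F (Suc k) t u - (2 * real k - 1) * F k t u)"
      using moment_recurrence[OF assms, of "k - 1"] by (cases k) (simp_all add: R_def algebra_simps)
    have u: "2 * u = R - \<gamma>\<^sup>2" by (simp add: R_def)
    let ?A = "R * F (Suc k) t u - 2 * real k * F k t u"
    \<comment> \<open>What \<open>R * F (k + 2) - 2 * (k + 1) * F (k + 1)\<close> becomes by
      \<open>F2\<close>.\<close>
    let ?A' = "\<delta>\<^sup>2 * t\<^sup>2 * F k t u - F (Suc k) t u"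
    have dk: "dF k t u = \<delta> * \<gamma> * F k t u - ?A / t" by (simp add: dF_def R_def)
    have dk1: "dF (Suc k) t u = \<delta> * \<gamma> * F (Suc k) t u - ?A' / t"
      unfolding dF_def R_def[symmetric] F2 by (simp add: algebra_simps)
    have "t\<^sup>2 * (\<delta> * \<gamma> * dF k t u - (R * dF (Suc k) t u - 2 * real k * dF k t u) / t + ?A / t\<^sup>2)
      = t\<^sup>2 * (2 * \<delta> * \<gamma> * dF k t u) + \<delta>\<^sup>2 * t\<^sup>2 * (R - \<gamma>\<^sup>2) * F k t u
        - 2 * (real k * (R * F (Suc k) t u - (2 * real k - 1) * F k t u))"
      unfolding dk dk1 using assms(1) by (simp add: field_simps power2_eq_square)
    also have "\<dots> = t\<^sup>2 * (2 * \<delta> * \<gamma> * dF k t u + 2 * \<delta>\<^sup>2 * (u * F k t u - real k * F (k - 1) t u))"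
      unfolding F0[symmetric] u[symmetric] by (simp add: algebra_simps)
    finally show ?thesis using assms(1) by simp
  qed
  finally show ?thesis .
qed

end

section \<open>The equation for the subordinated Poisson probabilities\<close>

theorem proposition2p1:
  fixes M :: "'a measure"
    and N :: "real \<Rightarrow> 'a \<Rightarrow> nat" and G :: "real \<Rightarrow> 'a \<Rightarrow> ereal"
    and p :: "int \<Rightarrow> real \<Rightarrow> real"
    and rate \<delta> \<gamma> t :: real and k :: int
  assumes "rate > 0" and "\<delta> > 0" and "\<gamma> \<ge> 0"
    and "poisson_process M rate N"
    and "inverse_gaussian_subordinator M \<delta> \<gamma> G"
    and "prob_space.indep_processes M (count_space UNIV) N borel G"
    and "\<And>j t. p j t = (if j \<ge> 0 then subordinated_prob M N G j t else 0)"
    and "k \<ge> 0" and "t > 0"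
  shows "p k differentiable (at t) \<and> deriv (p k) differentiable (at t) \<and>
    deriv (deriv (p k)) t - 2 * \<delta> * \<gamma> * deriv (p k) t = 2 * \<delta>\<^sup>2 * rate * (p k t - p (k - 1) t)"
proof -
  interpret poisson_process M rate N by fact
  obtain B where "brownian_motion M B"
    and G: "\<And>t \<omega>. 0 \<le> t \<Longrightarrow> \<omega> \<in> space M \<Longrightarrow> G t \<omega> = first_passage (\<lambda>s. B s \<omega> + \<gamma> * s) (\<delta> * t)"
    using assms(5) unfolding inverse_gaussian_subordinator_def first_passage_def by blast
  interpret brownian_motion M B by fact
  have indep: "indep_set (process_events M (count_space UNIV) N) (process_events M borel G)"
    using assms(6) by (simp add: indep_processes_def)
  have G_event: "G s -` S \<inter> space M \<in> process_events M borel G" if "0 \<le> s" "S \<in> sets borel" for s S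
    unfolding process_events_def using that by (intro sigma_sets.Basic) auto
  have N_event: "{\<omega> \<in> space M. N x \<omega> = j} \<in> process_events M (count_space UNIV) N" if "0 \<le> x" for x j
  proof -
    have "{\<omega> \<in> space M. N x \<omega> = j} = N x -` {j} \<inter> space M" by auto
    then show ?thesis unfolding process_events_def using that by (intro sigma_sets.Basic) auto
  qed
  \<comment> \<open>Independent families consist of events, so measurability of \<open>G s\<close>
    is contained in the independence assumption.\<close>
  have G_meas: "G s \<in> borel_measurable M" if "0 \<le> s" for s
    using G_event[OF that] indep_setD_ev2[OF indep] by (intro measurableI) auto
  have G_nonneg: "0 \<le> G s \<omega>" if "0 \<le> s" "\<omega> \<in> space M" for s \<omega>
    using G[OF that] first_passage_nonneg by simp
  interpret inverse_gaussian_moments "\<lambda>k t. laplace_moment (G t) k" \<delta> \<gamma>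
  proof
    fix s u :: real and k assume "0 < s" "0 < u"
    then show "(laplace_moment (G s) k has_real_derivative - laplace_moment (G s) (Suc k) u) (at u)"
      by (intro laplace_moment_DERIV G_meas G_nonneg) auto
    \<comment> \<open>The positive root of
      \<open>\<theta> * \<gamma> + \<theta>\<^sup>2 / 2 = u\<close>.\<close>
    define \<theta> where "\<theta> = sqrt (\<gamma>\<^sup>2 + 2 * u) - \<gamma>"
    have "\<gamma> < sqrt (\<gamma>\<^sup>2 + 2 * u)"
      using \<open>0 < u\<close> by (intro real_less_rsqrt) simp
    then have "0 < \<theta>" by (simp add: \<theta>_def)
    have "(\<theta> + \<gamma>)\<^sup>2 = \<gamma>\<^sup>2 + 2 * u"
      using \<open>0 < u\<close> by (simp add: \<theta>_def)
    then have u: "\<theta> * \<gamma> + \<theta>\<^sup>2 / 2 = u"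
      by (simp add: power2_eq_square algebra_simps)
    have "laplace_moment (G s) 0 u = expectation (\<lambda>\<omega>. if first_passage (\<lambda>s. B s \<omega> + \<gamma> * s) (\<delta> * s) = \<infinity> then 0
        else exp (- u * real_of_ereal (first_passage (\<lambda>s. B s \<omega> + \<gamma> * s) (\<delta> * s))))"
      unfolding laplace_moment_def using G \<open>0 < s\<close>
      by (intro Bochner_Integration.integral_cong) auto
    also have "\<dots> = exp (- \<theta> * (\<delta> * s))"
      using first_passage_laplace(2)[OF \<open>0 < \<theta>\<close> assms(3), of "\<delta> * s"] \<open>0 < s\<close> assms(2)
      unfolding u by simp
    finally show "laplace_moment (G s) 0 u = exp (- (sqrt (\<gamma>\<^sup>2 + 2 * u) - \<gamma>) * (\<delta> * s))"
      by (simp add: \<theta>_def)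
  qed
  have p_eq: "p (int j) s = rate ^ j / fact j * laplace_moment (G s) j rate" if "0 < s" for j s
  proof -
    have "p (int j) s = prob {\<omega> \<in> space M. \<exists>x. G s \<omega> = ereal x \<and> N x \<omega> = j}"
      by (simp add: assms(7) subordinated_prob_def)
    also have "\<dots> = expectation (\<lambda>\<omega>. if G s \<omega> = \<infinity> then 0 else
        exp (- rate * real_of_ereal (G s \<omega>)) * (rate * real_of_ereal (G s \<omega>)) ^ j / fact j)"
      using that assms(1)
      by (intro subordinated_prob_eq indep_setD[OF indep] G_event N_event G_meas G_nonneg) auto
    also have "\<dots> = expectation (\<lambda>\<omega>. rate ^ j / fact j * (if G s \<omega> = \<infinity> then 0 else
        real_of_ereal (G s \<omega>) ^ j * exp (- rate * real_of_ereal (G s \<omega>))))"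
      by (intro Bochner_Integration.integral_cong) (auto simp: power_mult_distrib)
    finally show ?thesis by (simp add: laplace_moment_def)
  qed
  obtain n where k: "k = int n" using assms(8) nonneg_int_cases by blast
  define c where "c = rate ^ n / fact n"
  \<comment> \<open>Needed at every positive time: the second derivative at \<open>t\<close>
    requires \<open>deriv (p k)\<close> on a neighbourhood.\<close>
  have p': "(p k has_real_derivative c * dF n s rate) (at s)" if "0 < s" for s
    by (rule has_field_derivative_transform_within_open[OF DERIV_cmult[OF time_DERIV[OF that assms(1)]], where S = "{0<..}"])
       (use that p_eq in \<open>auto simp: k c_def\<close>)
  then have deriv_p: "deriv (p k) s = c * dF n s rate" if "0 < s" for s
    using that by (intro DERIV_imp_deriv)
  have p'': "(deriv (p k) has_real_derivative c * (2 * \<delta> * \<gamma> * dF n t rate +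
      2 * \<delta>\<^sup>2 * (rate * laplace_moment (G t) n rate - real n * laplace_moment (G t) (n - 1) rate))) (at t)"
    by (rule has_field_derivative_transform_within_open[OF DERIV_cmult[OF time_ODE[OF assms(9,1)]], where S = "{0<..}"])
       (use assms(9) deriv_p in auto)
  \<comment> \<open>For \<open>n = 0\<close> both sides vanish, the left one by the convention for
    negative indices; otherwise the factor \<open>n\<close> cancels against
    \<open>fact n\<close>.\<close>
  have "p (k - 1) t * rate = c * (real n * laplace_moment (G t) (n - 1) rate)"
  proof (cases n)
    case 0
    then show ?thesis by (simp add: k assms(7))
  next
    case (Suc m)
    then have "k - 1 = int m" by (simp add: k)
    moreover have "c * real n = rate * (rate ^ m / fact m)"
      unfolding c_def Suc by (simp add: field_simps del: of_nat_Suc)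
    ultimately show ?thesis
      using p_eq[OF assms(9), of m] by (simp add: Suc mult.assoc[symmetric] del: of_nat_Suc)
  qed
  moreover have "p k t = c * laplace_moment (G t) n rate"
    using p_eq[OF assms(9)] by (simp add: k c_def)
  ultimately have "deriv (deriv (p k)) t - 2 * \<delta> * \<gamma> * deriv (p k) t = 2 * \<delta>\<^sup>2 * rate * (p k t - p (k - 1) t)"
    unfolding DERIV_imp_deriv[OF p''] deriv_p[OF assms(9)] by (simp add: algebra_simps)
  moreover have "p k differentiable (at t)" "deriv (p k) differentiable (at t)"
    using p'[OF assms(9)] p'' real_differentiable_def by blast+
  ultimately show ?thesis by blast
qed

end
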